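(* There is no term $t$ such that $\mathrm{MLTT}\vdash t : \mathsf{MP}$, where $$\mathsf{MP} := \Pi(h : \mathsf{N}\to \mathsf{N}_2)\big[\neg\neg(\Sigma(x:\mathsf{N})\,\mathsf{IsZero}\,(h\,x)) \to \Sigma(x:\mathsf{N})\,\mathsf{IsZero}\,(h\,x)\big],$$ $\neg A := A\to \mathsf{N}_0$, and $\mathsf{IsZero} : \mathsf{N}_2\to\mathsf{U}$ is $\mathsf{IsZero} := \lambda y.\,\mathsf{rec}_{\mathsf{N}_2}(\lambda x.\mathsf{U})\,\mathsf{N}_1\,\mathsf{N}_0\,y$.
   Context: $\mathrm{MLTT}$ denotes Martin-Löf dependent type theory with: judgments $\Gamma\vdash$, $\Gamma\vdash A$, $\Gamma\vdash A=B$, $\Gamma\vdash t:A$, $\Gamma\vdash t=u:A$ (conversion is a judgment); an empty type $\mathsf{N}_0$ with eliminator $\mathsf{rec}_{\mathsf{N}_0}$; a unit type $\mathsf{N}_1$ with element $\mathsf{0}$ and eliminator $\mathsf{rec}_{\mathsf{N}_1}$; booleans $\mathsf{N}_2$ with elements $\mathsf{0},\mathsf{1}$ and dependent eliminator $\mathsf{rec}_{\mathsf{N}_2}(\lambda x.F)\,a_0\,a_1 : \Pi(x:\mathsf{N}_2)F$ satisfying $\mathsf{rec}_{\mathsf{N}_2}(\lambda x.F)\,a_0\,a_1\,\mathsf{0}=a_0$, $\ldots\,\mathsf{1}=a_1$; natural numbers $\mathsf{N}$ with $\mathsf{0}$, $\mathsf{S}$ and dependent recursor $\mathsf{rec}_\mathsf{N}$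 with the usual computation rules; dependent function types $\Pi$ with $\lambda$, application, $\beta$-conversion and the extensionality rule (if $h,g:\Pi(x:F)G$ and $\Gamma,x:F\vdash h\,x=g\,x:G[x]$ then $h=g$); dependent pair types $\Sigma$ with pairing, projections $.1,.2$, their computation rules and surjective pairing (if $t.1=u.1$ and $t.2=u.2$ then $t=u$); one universe $\mathsf{U}$ à la Russell (elements of $\mathsf{U}$ are types) containing $\mathsf{N}_0,\mathsf{N}_1,\mathsf{N}_2,\mathsf{N}$ and closed under $\Pi$ and $\Sigma$; together with the usual congruence, symmetry, transitivity and type-conversion rules. *)

theory Defs
  imports Main
begin

text \<open>
  Raw expressions, with de Bruijn indices. As the universe is \<open>a la\<close> Russell, types and terms share
  one syntactic category. \<open>PiT A B\<close>, \<open>SigT A B\<close> bind one variable in \<open>B\<close>; \<open>Lam t\<close> (unannotated)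
  binds one variable in \<open>t\<close>; each eliminator binds one variable in its motive \<open>F\<close> only, and is itself
  an expression of dependent function type, to be applied to its scrutinee.
  As in the informal notation, the same symbol \<open>0\<close> is the element of \<open>N1\<close>, the first element
  of \<open>N2\<close> and the number zero.
\<close>

datatype tm =
    Var nat
  | N0 | N1 | N2 | NN | UU
  | PiT tm tm | SigT tm tm
  | Lam tm | App tm tm
  | MkPair tm tm | Proj1 tm | Proj2 tm
  | TZero | TOne | TSucc tm
  | RecN0 tm
  | RecN1 tm tm
  | RecN2 tm tm tm
  | RecN tm tm tm

definition up_ren :: "(nat \<Rightarrow> nat) \<Rightarrow> nat \<Rightarrow> nat" where
  "up_ren r = case_nat 0 (\<lambda>i. Suc (r i))"

primrec ren :: "(nat \<Rightarrow> nat) \<Rightarrow> tm \<Rightarrow> tm" where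
  "ren r (Var i) = Var (r i)"
| "ren r N0 = N0"
| "ren r N1 = N1"
| "ren r N2 = N2"
| "ren r NN = NN"
| "ren r UU = UU"
| "ren r (PiT A B) = PiT (ren r A) (ren (up_ren r) B)"
| "ren r (SigT A B) = SigT (ren r A) (ren (up_ren r) B)"
| "ren r (Lam t) = Lam (ren (up_ren r) t)"
| "ren r (App t u) = App (ren r t) (ren r u)"
| "ren r (MkPair t u) = MkPair (ren r t) (ren r u)"
| "ren r (Proj1 t) = Proj1 (ren r t)"
| "ren r (Proj2 t) = Proj2 (ren r t)"
| "ren r TZero = TZero"
| "ren r TOne = TOne"
| "ren r (TSucc t) = TSucc (ren r t)"
| "ren r (RecN0 F) = RecN0 (ren (up_ren r) F)"
| "ren r (RecN1 F a) = RecN1 (ren (up_ren r) F) (ren r a)"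
| "ren r (RecN2 F a b) = RecN2 (ren (up_ren r) F) (ren r a) (ren r b)"
| "ren r (RecN F a g) = RecN (ren (up_ren r) F) (ren r a) (ren r g)"

abbreviation wk :: "tm \<Rightarrow> tm" where
  "wk \<equiv> ren Suc"

definition up :: "(nat \<Rightarrow> tm) \<Rightarrow> nat \<Rightarrow> tm" where
  "up s = case_nat (Var 0) (\<lambda>i. wk (s i))"

primrec subst :: "(nat \<Rightarrow> tm) \<Rightarrow> tm \<Rightarrow> tm" where
  "subst s (Var i) = s i"
| "subst s N0 = N0"
| "subst s N1 = N1"
| "subst s N2 = N2"
| "subst s NN = NN"
| "subst s UU = UU"
| "subst s (PiT A B) = PiT (subst s A) (subst (up s) B)"
| "subst s (SigT A B) = SigT (subst s A) (subst (up s) B)"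
| "subst s (Lam t) = Lam (subst (up s) t)"
| "subst s (App t u) = App (subst s t) (subst s u)"
| "subst s (MkPair t u) = MkPair (subst s t) (subst s u)"
| "subst s (Proj1 t) = Proj1 (subst s t)"
| "subst s (Proj2 t) = Proj2 (subst s t)"
| "subst s TZero = TZero"
| "subst s TOne = TOne"
| "subst s (TSucc t) = TSucc (subst s t)"
| "subst s (RecN0 F) = RecN0 (subst (up s) F)"
| "subst s (RecN1 F a) = RecN1 (subst (up s) F) (subst s a)"
| "subst s (RecN2 F a b) = RecN2 (subst (up s) F) (subst s a) (subst s b)"
| "subst s (RecN F a g) = RecN (subst (up s) F) (subst s a) (subst s g)"

definition inst :: "tm \<Rightarrow> tm \<Rightarrow> tm"  ("_\<lbrakk>_\<rbrakk>" [1000, 0] 1000) where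
  "F\<lbrakk>a\<rbrakk> = subst (case_nat a Var) F"

text \<open>For \<open>F\<close> over \<open>\<Gamma>, x : N\<close>, the expression \<open>F[S x]\<close>, again over \<open>\<Gamma>, x : N\<close>.\<close>

definition inst_succ :: "tm \<Rightarrow> tm" where
  "inst_succ F = subst (case_nat (TSucc (Var 0)) (\<lambda>i. Var (Suc i))) F"

definition Arr :: "tm \<Rightarrow> tm \<Rightarrow> tm" where
  "Arr A B = PiT A (wk B)"

definition Neg :: "tm \<Rightarrow> tm" where
  "Neg A = Arr A N0"

text \<open>The type \<open>\<Pi>(x : N)(F[x] \<rightarrow> F[S x])\<close> of the step argument of the recursor.\<close>

definition step_ty :: "tm \<Rightarrow> tm" where
  "step_ty F = PiT NN (Arr F (inst_succ F))"

text \<open>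
  Contexts are lists whose head is the most recently declared variable, so \<open>A # \<Gamma>\<close> is \<open>\<Gamma>, x : A\<close>,
  and \<open>\<Gamma> ! i\<close> is an expression over the variables declared before \<open>Var i\<close>.
\<close>

inductive wf_ctx :: "tm list \<Rightarrow> bool"  ("\<turnstile> _" [51] 50)
  and is_type :: "tm list \<Rightarrow> tm \<Rightarrow> bool"  ("_ \<turnstile> _" [51, 51] 50)
  and eq_type :: "tm list \<Rightarrow> tm \<Rightarrow> tm \<Rightarrow> bool"  ("_ \<turnstile> _ \<simeq> _" [51, 51, 51] 50)
  and has_type :: "tm list \<Rightarrow> tm \<Rightarrow> tm \<Rightarrow> bool"  ("_ \<turnstile> _ \<Ztypecolon> _" [51, 51, 51] 50)
  and eq_term :: "tm list \<Rightarrow> tm \<Rightarrow> tm \<Rightarrow> tm \<Rightarrow> bool"  ("_ \<turnstile> _ \<simeq> _ \<Ztypecolon> _" [51, 51, 51, 51] 50)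
where
  ctx_empty: "\<turnstile> []"
| ctx_ext: "\<Gamma> \<turnstile> A \<Longrightarrow> \<turnstile> A # \<Gamma>"

| var: "\<turnstile> \<Gamma> \<Longrightarrow> i < length \<Gamma> \<Longrightarrow> \<Gamma> \<turnstile> Var i \<Ztypecolon> ren (\<lambda>j. j + Suc i) (\<Gamma> ! i)"

| type_refl: "\<Gamma> \<turnstile> A \<Longrightarrow> \<Gamma> \<turnstile> A \<simeq> A"
| type_sym: "\<Gamma> \<turnstile> A \<simeq> B \<Longrightarrow> \<Gamma> \<turnstile> B \<simeq> A"
| type_trans: "\<Gamma> \<turnstile> A \<simeq> B \<Longrightarrow> \<Gamma> \<turnstile> B \<simeq> C \<Longrightarrow> \<Gamma> \<turnstile> A \<simeq> C"
| term_refl: "\<Gamma> \<turnstile> t \<Ztypecolon> A \<Longrightarrow> \<Gamma> \<turnstile> t \<simeq> t \<Ztypecolon> A"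
| term_sym: "\<Gamma> \<turnstile> t \<simeq> u \<Ztypecolon> A \<Longrightarrow> \<Gamma> \<turnstile> u \<simeq> t \<Ztypecolon> A"
| term_trans: "\<Gamma> \<turnstile> t \<simeq> u \<Ztypecolon> A \<Longrightarrow> \<Gamma> \<turnstile> u \<simeq> v \<Ztypecolon> A \<Longrightarrow> \<Gamma> \<turnstile> t \<simeq> v \<Ztypecolon> A"
| conv: "\<Gamma> \<turnstile> t \<Ztypecolon> A \<Longrightarrow> \<Gamma> \<turnstile> A \<simeq> B \<Longrightarrow> \<Gamma> \<turnstile> t \<Ztypecolon> B"
| conv_eq: "\<Gamma> \<turnstile> t \<simeq> u \<Ztypecolon> A \<Longrightarrow> \<Gamma> \<turnstile> A \<simeq> B \<Longrightarrow> \<Gamma> \<turnstile> t \<simeq> u \<Ztypecolon> B"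

| N0_form: "\<turnstile> \<Gamma> \<Longrightarrow> \<Gamma> \<turnstile> N0"
| N0_elim: "N0 # \<Gamma> \<turnstile> F \<Longrightarrow> \<Gamma> \<turnstile> RecN0 F \<Ztypecolon> PiT N0 F"
| N0_elim_cong: "N0 # \<Gamma> \<turnstile> F \<simeq> F' \<Longrightarrow> \<Gamma> \<turnstile> RecN0 F \<simeq> RecN0 F' \<Ztypecolon> PiT N0 F"

| N1_form: "\<turnstile> \<Gamma> \<Longrightarrow> \<Gamma> \<turnstile> N1"
| N1_zero: "\<turnstile> \<Gamma> \<Longrightarrow> \<Gamma> \<turnstile> TZero \<Ztypecolon> N1"
| N1_elim: "N1 # \<Gamma> \<turnstile> F \<Longrightarrow> \<Gamma> \<turnstile> a \<Ztypecolon> F\<lbrakk>TZero\<rbrakk> \<Longrightarrow> \<Gamma> \<turnstile> RecN1 F a \<Ztypecolon> PiT N1 F"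
| N1_elim_cong: "N1 # \<Gamma> \<turnstile> F \<simeq> F' \<Longrightarrow> \<Gamma> \<turnstile> a \<simeq> a' \<Ztypecolon> F\<lbrakk>TZero\<rbrakk> \<Longrightarrow>
    \<Gamma> \<turnstile> RecN1 F a \<simeq> RecN1 F' a' \<Ztypecolon> PiT N1 F"
| N1_comp: "N1 # \<Gamma> \<turnstile> F \<Longrightarrow> \<Gamma> \<turnstile> a \<Ztypecolon> F\<lbrakk>TZero\<rbrakk> \<Longrightarrow>
    \<Gamma> \<turnstile> App (RecN1 F a) TZero \<simeq> a \<Ztypecolon> F\<lbrakk>TZero\<rbrakk>"

| N2_form: "\<turnstile> \<Gamma> \<Longrightarrow> \<Gamma> \<turnstile> N2"
| N2_zero: "\<turnstile> \<Gamma> \<Longrightarrow> \<Gamma> \<turnstile> TZero \<Ztypecolon> N2"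
| N2_one: "\<turnstile> \<Gamma> \<Longrightarrow> \<Gamma> \<turnstile> TOne \<Ztypecolon> N2"
| N2_elim: "N2 # \<Gamma> \<turnstile> F \<Longrightarrow> \<Gamma> \<turnstile> a \<Ztypecolon> F\<lbrakk>TZero\<rbrakk> \<Longrightarrow> \<Gamma> \<turnstile> b \<Ztypecolon> F\<lbrakk>TOne\<rbrakk> \<Longrightarrow>
    \<Gamma> \<turnstile> RecN2 F a b \<Ztypecolon> PiT N2 F"
| N2_elim_cong: "N2 # \<Gamma> \<turnstile> F \<simeq> F' \<Longrightarrow> \<Gamma> \<turnstile> a \<simeq> a' \<Ztypecolon> F\<lbrakk>TZero\<rbrakk> \<Longrightarrow> \<Gamma> \<turnstile> b \<simeq> b' \<Ztypecolon> F\<lbrakk>TOne\<rbrakk> \<Longrightarrow>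
    \<Gamma> \<turnstile> RecN2 F a b \<simeq> RecN2 F' a' b' \<Ztypecolon> PiT N2 F"
| N2_comp_zero: "N2 # \<Gamma> \<turnstile> F \<Longrightarrow> \<Gamma> \<turnstile> a \<Ztypecolon> F\<lbrakk>TZero\<rbrakk> \<Longrightarrow> \<Gamma> \<turnstile> b \<Ztypecolon> F\<lbrakk>TOne\<rbrakk> \<Longrightarrow>
    \<Gamma> \<turnstile> App (RecN2 F a b) TZero \<simeq> a \<Ztypecolon> F\<lbrakk>TZero\<rbrakk>"
| N2_comp_one: "N2 # \<Gamma> \<turnstile> F \<Longrightarrow> \<Gamma> \<turnstile> a \<Ztypecolon> F\<lbrakk>TZero\<rbrakk> \<Longrightarrow> \<Gamma> \<turnstile> b \<Ztypecolon> F\<lbrakk>TOne\<rbrakk> \<Longrightarrow>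
    \<Gamma> \<turnstile> App (RecN2 F a b) TOne \<simeq> b \<Ztypecolon> F\<lbrakk>TOne\<rbrakk>"

| N_form: "\<turnstile> \<Gamma> \<Longrightarrow> \<Gamma> \<turnstile> NN"
| N_zero: "\<turnstile> \<Gamma> \<Longrightarrow> \<Gamma> \<turnstile> TZero \<Ztypecolon> NN"
| N_succ: "\<Gamma> \<turnstile> n \<Ztypecolon> NN \<Longrightarrow> \<Gamma> \<turnstile> TSucc n \<Ztypecolon> NN"
| N_succ_cong: "\<Gamma> \<turnstile> n \<simeq> n' \<Ztypecolon> NN \<Longrightarrow> \<Gamma> \<turnstile> TSucc n \<simeq> TSucc n' \<Ztypecolon> NN"
| N_elim: "NN # \<Gamma> \<turnstile> F \<Longrightarrow> \<Gamma> \<turnstile> a \<Ztypecolon> F\<lbrakk>TZero\<rbrakk> \<Longrightarrow> \<Gamma> \<turnstile> g \<Ztypecolon> step_ty F \<Longrightarrow>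
    \<Gamma> \<turnstile> RecN F a g \<Ztypecolon> PiT NN F"
| N_elim_cong: "NN # \<Gamma> \<turnstile> F \<simeq> F' \<Longrightarrow> \<Gamma> \<turnstile> a \<simeq> a' \<Ztypecolon> F\<lbrakk>TZero\<rbrakk> \<Longrightarrow> \<Gamma> \<turnstile> g \<simeq> g' \<Ztypecolon> step_ty F \<Longrightarrow>
    \<Gamma> \<turnstile> RecN F a g \<simeq> RecN F' a' g' \<Ztypecolon> PiT NN F"
| N_comp_zero: "NN # \<Gamma> \<turnstile> F \<Longrightarrow> \<Gamma> \<turnstile> a \<Ztypecolon> F\<lbrakk>TZero\<rbrakk> \<Longrightarrow> \<Gamma> \<turnstile> g \<Ztypecolon> step_ty F \<Longrightarrow>
    \<Gamma> \<turnstile> App (RecN F a g) TZero \<simeq> a \<Ztypecolon> F\<lbrakk>TZero\<rbrakk>"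
| N_comp_succ: "NN # \<Gamma> \<turnstile> F \<Longrightarrow> \<Gamma> \<turnstile> a \<Ztypecolon> F\<lbrakk>TZero\<rbrakk> \<Longrightarrow> \<Gamma> \<turnstile> g \<Ztypecolon> step_ty F \<Longrightarrow> \<Gamma> \<turnstile> n \<Ztypecolon> NN \<Longrightarrow>
    \<Gamma> \<turnstile> App (RecN F a g) (TSucc n) \<simeq> App (App g n) (App (RecN F a g) n) \<Ztypecolon> F\<lbrakk>TSucc n\<rbrakk>"

| Pi_form: "\<Gamma> \<turnstile> A \<Longrightarrow> A # \<Gamma> \<turnstile> B \<Longrightarrow> \<Gamma> \<turnstile> PiT A B"
| Pi_cong: "\<Gamma> \<turnstile> A \<simeq> A' \<Longrightarrow> A # \<Gamma> \<turnstile> B \<simeq> B' \<Longrightarrow> \<Gamma> \<turnstile> PiT A B \<simeq> PiT A' B'"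
| Pi_intro: "A # \<Gamma> \<turnstile> t \<Ztypecolon> B \<Longrightarrow> \<Gamma> \<turnstile> Lam t \<Ztypecolon> PiT A B"
| Pi_intro_cong: "A # \<Gamma> \<turnstile> t \<simeq> t' \<Ztypecolon> B \<Longrightarrow> \<Gamma> \<turnstile> Lam t \<simeq> Lam t' \<Ztypecolon> PiT A B"
| Pi_elim: "\<Gamma> \<turnstile> h \<Ztypecolon> PiT A B \<Longrightarrow> \<Gamma> \<turnstile> a \<Ztypecolon> A \<Longrightarrow> \<Gamma> \<turnstile> App h a \<Ztypecolon> B\<lbrakk>a\<rbrakk>"
| Pi_elim_cong: "\<Gamma> \<turnstile> h \<simeq> h' \<Ztypecolon> PiT A B \<Longrightarrow> \<Gamma> \<turnstile> a \<simeq> a' \<Ztypecolon> A \<Longrightarrow>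
    \<Gamma> \<turnstile> App h a \<simeq> App h' a' \<Ztypecolon> B\<lbrakk>a\<rbrakk>"
| Pi_beta: "A # \<Gamma> \<turnstile> t \<Ztypecolon> B \<Longrightarrow> \<Gamma> \<turnstile> a \<Ztypecolon> A \<Longrightarrow> \<Gamma> \<turnstile> App (Lam t) a \<simeq> t\<lbrakk>a\<rbrakk> \<Ztypecolon> B\<lbrakk>a\<rbrakk>"
| Pi_ext: "\<Gamma> \<turnstile> h \<Ztypecolon> PiT A B \<Longrightarrow> \<Gamma> \<turnstile> g \<Ztypecolon> PiT A B \<Longrightarrow>
    A # \<Gamma> \<turnstile> App (wk h) (Var 0) \<simeq> App (wk g) (Var 0) \<Ztypecolon> B \<Longrightarrow> \<Gamma> \<turnstile> h \<simeq> g \<Ztypecolon> PiT A B"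

| Sig_form: "\<Gamma> \<turnstile> A \<Longrightarrow> A # \<Gamma> \<turnstile> B \<Longrightarrow> \<Gamma> \<turnstile> SigT A B"
| Sig_cong: "\<Gamma> \<turnstile> A \<simeq> A' \<Longrightarrow> A # \<Gamma> \<turnstile> B \<simeq> B' \<Longrightarrow> \<Gamma> \<turnstile> SigT A B \<simeq> SigT A' B'"
| Sig_intro: "A # \<Gamma> \<turnstile> B \<Longrightarrow> \<Gamma> \<turnstile> a \<Ztypecolon> A \<Longrightarrow> \<Gamma> \<turnstile> b \<Ztypecolon> B\<lbrakk>a\<rbrakk> \<Longrightarrow> \<Gamma> \<turnstile> MkPair a b \<Ztypecolon> SigT A B"
| Sig_intro_cong: "A # \<Gamma> \<turnstile> B \<Longrightarrow> \<Gamma> \<turnstile> a \<simeq> a' \<Ztypecolon> A \<Longrightarrow> \<Gamma> \<turnstile> b \<simeq> b' \<Ztypecolon> B\<lbrakk>a\<rbrakk> \<Longrightarrow>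
    \<Gamma> \<turnstile> MkPair a b \<simeq> MkPair a' b' \<Ztypecolon> SigT A B"
| Sig_fst: "\<Gamma> \<turnstile> t \<Ztypecolon> SigT A B \<Longrightarrow> \<Gamma> \<turnstile> Proj1 t \<Ztypecolon> A"
| Sig_fst_cong: "\<Gamma> \<turnstile> t \<simeq> t' \<Ztypecolon> SigT A B \<Longrightarrow> \<Gamma> \<turnstile> Proj1 t \<simeq> Proj1 t' \<Ztypecolon> A"
| Sig_snd: "\<Gamma> \<turnstile> t \<Ztypecolon> SigT A B \<Longrightarrow> \<Gamma> \<turnstile> Proj2 t \<Ztypecolon> B\<lbrakk>Proj1 t\<rbrakk>"
| Sig_snd_cong: "\<Gamma> \<turnstile> t \<simeq> t' \<Ztypecolon> SigT A B \<Longrightarrow> \<Gamma> \<turnstile> Proj2 t \<simeq> Proj2 t' \<Ztypecolon> B\<lbrakk>Proj1 t\<rbrakk>"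
| Sig_comp_fst: "A # \<Gamma> \<turnstile> B \<Longrightarrow> \<Gamma> \<turnstile> a \<Ztypecolon> A \<Longrightarrow> \<Gamma> \<turnstile> b \<Ztypecolon> B\<lbrakk>a\<rbrakk> \<Longrightarrow>
    \<Gamma> \<turnstile> Proj1 (MkPair a b) \<simeq> a \<Ztypecolon> A"
| Sig_comp_snd: "A # \<Gamma> \<turnstile> B \<Longrightarrow> \<Gamma> \<turnstile> a \<Ztypecolon> A \<Longrightarrow> \<Gamma> \<turnstile> b \<Ztypecolon> B\<lbrakk>a\<rbrakk> \<Longrightarrow>
    \<Gamma> \<turnstile> Proj2 (MkPair a b) \<simeq> b \<Ztypecolon> B\<lbrakk>a\<rbrakk>"
| Sig_ext: "\<Gamma> \<turnstile> t \<Ztypecolon> SigT A B \<Longrightarrow> \<Gamma> \<turnstile> u \<Ztypecolon> SigT A B \<Longrightarrow>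
    \<Gamma> \<turnstile> Proj1 t \<simeq> Proj1 u \<Ztypecolon> A \<Longrightarrow> \<Gamma> \<turnstile> Proj2 t \<simeq> Proj2 u \<Ztypecolon> B\<lbrakk>Proj1 t\<rbrakk> \<Longrightarrow>
    \<Gamma> \<turnstile> t \<simeq> u \<Ztypecolon> SigT A B"

| U_form: "\<turnstile> \<Gamma> \<Longrightarrow> \<Gamma> \<turnstile> UU"
| U_type: "\<Gamma> \<turnstile> A \<Ztypecolon> UU \<Longrightarrow> \<Gamma> \<turnstile> A"
| U_type_eq: "\<Gamma> \<turnstile> A \<simeq> B \<Ztypecolon> UU \<Longrightarrow> \<Gamma> \<turnstile> A \<simeq> B"
| U_N0: "\<turnstile> \<Gamma> \<Longrightarrow> \<Gamma> \<turnstile> N0 \<Ztypecolon> UU"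
| U_N1: "\<turnstile> \<Gamma> \<Longrightarrow> \<Gamma> \<turnstile> N1 \<Ztypecolon> UU"
| U_N2: "\<turnstile> \<Gamma> \<Longrightarrow> \<Gamma> \<turnstile> N2 \<Ztypecolon> UU"
| U_N: "\<turnstile> \<Gamma> \<Longrightarrow> \<Gamma> \<turnstile> NN \<Ztypecolon> UU"
| U_Pi: "\<Gamma> \<turnstile> A \<Ztypecolon> UU \<Longrightarrow> A # \<Gamma> \<turnstile> B \<Ztypecolon> UU \<Longrightarrow> \<Gamma> \<turnstile> PiT A B \<Ztypecolon> UU"
| U_Pi_cong: "\<Gamma> \<turnstile> A \<simeq> A' \<Ztypecolon> UU \<Longrightarrow> A # \<Gamma> \<turnstile> B \<simeq> B' \<Ztypecolon> UU \<Longrightarrow>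
    \<Gamma> \<turnstile> PiT A B \<simeq> PiT A' B' \<Ztypecolon> UU"
| U_Sig: "\<Gamma> \<turnstile> A \<Ztypecolon> UU \<Longrightarrow> A # \<Gamma> \<turnstile> B \<Ztypecolon> UU \<Longrightarrow> \<Gamma> \<turnstile> SigT A B \<Ztypecolon> UU"
| U_Sig_cong: "\<Gamma> \<turnstile> A \<simeq> A' \<Ztypecolon> UU \<Longrightarrow> A # \<Gamma> \<turnstile> B \<simeq> B' \<Ztypecolon> UU \<Longrightarrow>
    \<Gamma> \<turnstile> SigT A B \<simeq> SigT A' B' \<Ztypecolon> UU"

text \<open>\<open>IsZero\<close> is closed, so it needs no weakening under binders.\<close>

definition IsZero :: tm where
  "IsZero = Lam (App (RecN2 UU N1 N0) (Var 0))"

text \<open>\<open>\<Sigma>(x : N) IsZero (h x)\<close>.\<close>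

definition SomeZero :: "tm \<Rightarrow> tm" where
  "SomeZero h = SigT NN (App IsZero (App (wk h) (Var 0)))"

definition MP :: tm where
  "MP = PiT (Arr NN N2) (Arr (Neg (Neg (SomeZero (Var 0)))) (SomeZero (Var 0)))"

end

theory Submission
  imports Defs
begin

text \<open>
  Terms are interpreted in a graph model of the untyped lambda calculus with an exception that
  propagates through application, projections and recursors. Types are partial equivalence relations
  indexed by two worlds: in the actual world \<open>N0\<close> is empty, in the potential one the exception
  inhabits every type; a function of the actual world also maps potential elements to
  potential elements. If \<open>t\<close> proves \<open>MP\<close>, apply it to a sequence \<open>h\<close> and to the exception.
  For every \<open>h\<close> the result is potential, so it yields a number, or an exceptional number,
  already for the constant sequence one. By continuity finitely many values of \<open>h\<close> determine it,
  hence it does not change when a zero is inserted at some \<open>m\<close> beyond those values and different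
  from that number. But with a zero, \<open>\<not>\<not>\<Sigma>(x : N) IsZero (h x)\<close> actually holds of the exception
  (\<open>\<not>\<Sigma>(x : N) IsZero (h x)\<close> being empty in the actual world), so the result would have to be \<open>m\<close>.
\<close>

section \<open>A graph model with an exception\<close>

datatype atom = AtN0 | AtN1 | AtN2 | AtN

text \<open>Tokens are finite pieces of information, and a point of the domain is any set of them.
  \<open>Fn xs b\<close> is the step that outputs \<open>b\<close> once all of \<open>xs\<close> is
  known of the argument; the list stands for a finite set. The last four constructors serve for
  codes of types.\<close>

datatype tok =
    Err | Zer | One | Su tok
  | Fn "tok list" tok | Fst tok | Snd tok
  | Atm atom | Unv | PiTag | SigTag

type_synonym dom = "tok set"

text \<open>Graph application, extended by the rule that an exception in function position passes to
  the result.\<close>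

definition app :: "dom \<Rightarrow> dom \<Rightarrow> dom" where
  "app X Y = (\<Union>s\<in>X. case s of Fn xs b \<Rightarrow> if set xs \<subseteq> Y then {b} else {} | Err \<Rightarrow> {Err} | _ \<Rightarrow> {})"

definition lam :: "(dom \<Rightarrow> dom) \<Rightarrow> dom" where
  "lam G = {Fn xs b |xs b. b \<in> G (set xs)}"

definition pair :: "dom \<Rightarrow> dom \<Rightarrow> dom" where
  "pair X Y = (\<Union>s\<in>X. {Fst s}) \<union> (\<Union>s\<in>Y. {Snd s})"

definition proj1 :: "dom \<Rightarrow> dom" where
  "proj1 X = (\<Union>s\<in>X. case s of Fst b \<Rightarrow> {b} | Err \<Rightarrow> {Err} | _ \<Rightarrow> {})"

definition proj2 :: "dom \<Rightarrow> dom" where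
  "proj2 X = (\<Union>s\<in>X. case s of Snd b \<Rightarrow> {b} | Err \<Rightarrow> {Err} | _ \<Rightarrow> {})"

text \<open>Unlike the eliminators, the successor does not propagate the exception:
  \<open>succ {Err}\<close> is \<open>{Su Err}\<close>. Collapsing it to \<open>{Err}\<close> would
  break the successor equation of the recursor, whose right side at \<open>Err\<close> is
  \<open>app (app g {Err}) {Err}\<close>.\<close>

definition succ :: "dom \<Rightarrow> dom" where
  "succ X = (\<Union>s\<in>X. {Su s})"

text \<open>One recursion serves all four base types, since their elements share tokens:
  \<open>a\<close> is the branch at zero, \<open>b\<close> that at the second boolean,
  \<open>g\<close> that at successors. A branch that a type lacks is filled with
  \<open>{}\<close>.\<close>

primrec tok_rec :: "dom \<Rightarrow> dom \<Rightarrow> dom \<Rightarrow> tok \<Rightarrow> dom" where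
  "tok_rec a b g Err = {Err}"
| "tok_rec a b g Zer = a"
| "tok_rec a b g One = b"
| "tok_rec a b g (Su s) = app (app g {s}) (tok_rec a b g s)"
| "tok_rec a b g (Fn xs s) = {}"
| "tok_rec a b g (Fst s) = {}"
| "tok_rec a b g (Snd s) = {}"
| "tok_rec a b g (Atm c) = {}"
| "tok_rec a b g Unv = {}"
| "tok_rec a b g PiTag = {}"
| "tok_rec a b g SigTag = {}"

definition elim :: "dom \<Rightarrow> dom \<Rightarrow> dom \<Rightarrow> dom \<Rightarrow> dom" where
  "elim a b g x = (\<Union>s\<in>x. tok_rec a b g s)"

text \<open>A type is coded by a point of the domain, with its family as a function graph; the tag
  makes the outermost type former recoverable.\<close>

definition pi_code :: "dom \<Rightarrow> dom \<Rightarrow> dom" where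
  "pi_code A F = {PiTag} \<union> pair A F"

definition sig_code :: "dom \<Rightarrow> dom \<Rightarrow> dom" where
  "sig_code A F = {SigTag} \<union> pair A F"

primrec den :: "tm \<Rightarrow> (nat \<Rightarrow> dom) \<Rightarrow> dom" where
  "den (Var i) \<rho> = \<rho> i"
| "den N0 \<rho> = {Atm AtN0}"
| "den N1 \<rho> = {Atm AtN1}"
| "den N2 \<rho> = {Atm AtN2}"
| "den NN \<rho> = {Atm AtN}"
| "den UU \<rho> = {Unv}"
| "den (PiT A B) \<rho> = pi_code (den A \<rho>) (lam (\<lambda>x. den B (case_nat x \<rho>)))"
| "den (SigT A B) \<rho> = sig_code (den A \<rho>) (lam (\<lambda>x. den B (case_nat x \<rho>)))"
| "den (Lam t) \<rho> = lam (\<lambda>x. den t (case_nat x \<rho>))"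
| "den (App t u) \<rho> = app (den t \<rho>) (den u \<rho>)"
| "den (MkPair t u) \<rho> = pair (den t \<rho>) (den u \<rho>)"
| "den (Proj1 t) \<rho> = proj1 (den t \<rho>)"
| "den (Proj2 t) \<rho> = proj2 (den t \<rho>)"
| "den TZero \<rho> = {Zer}"
| "den TOne \<rho> = {One}"
| "den (TSucc t) \<rho> = succ (den t \<rho>)"
| "den (RecN0 F) \<rho> = lam (elim {} {} {})"
| "den (RecN1 F a) \<rho> = lam (elim (den a \<rho>) {} {})"
| "den (RecN2 F a b) \<rho> = lam (elim (den a \<rho>) (den b \<rho>) {})"
| "den (RecN F a g) \<rho> = lam (elim (den a \<rho>) {} (den g \<rho>))"

section \<open>Elementary laws of the operations and of type codes\<close>

lemma in_app_iff: "b \<in> app X Y \<longleftrightarrow> (\<exists>xs. Fn xs b \<in> X \<and> set xs \<subseteq> Y) \<or> b = Err \<and> Err \<in> X"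
proof
  assume "b \<in> app X Y"
  then obtain s where "s \<in> X"
    "b \<in> (case s of Fn xs b \<Rightarrow> if set xs \<subseteq> Y then {b} else {} | Err \<Rightarrow> {Err} | _ \<Rightarrow> {})"
    unfolding app_def by blast
  then show "(\<exists>xs. Fn xs b \<in> X \<and> set xs \<subseteq> Y) \<or> b = Err \<and> Err \<in> X"
    by (cases s) (auto split: if_splits)
next
  assume "(\<exists>xs. Fn xs b \<in> X \<and> set xs \<subseteq> Y) \<or> b = Err \<and> Err \<in> X"
  then consider xs where "Fn xs b \<in> X" "set xs \<subseteq> Y" | "b = Err" "Err \<in> X" by blast
  then show "b \<in> app X Y"
  proof cases
    case 1
    then show ?thesis unfolding app_def by (intro UN_I[of "Fn xs b"]) auto
  next
    case 2
    then show ?thesis unfolding app_def by (intro UN_I[of Err]) auto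
  qed
qed

lemma app_raise [simp]: "app {Err} Y = {Err}"
  by (simp add: app_def)

lemma proj1_pair [simp]: "proj1 (pair X Y) = X"
  by (force simp: proj1_def pair_def split: tok.splits)

lemma proj2_pair [simp]: "proj2 (pair X Y) = Y"
  by (force simp: proj2_def pair_def split: tok.splits)

lemma proj1_raise [simp]: "proj1 {Err} = {Err}"
  by (simp add: proj1_def)

lemma proj2_raise [simp]: "proj2 {Err} = {Err}"
  by (simp add: proj2_def)

lemma elim_token [simp]: "elim a b g {s} = tok_rec a b g s"
  by (simp add: elim_def)

lemma succ_token [simp]: "succ {s} = {Su s}"
  by (simp add: succ_def)

lemma pair_eq_iff: "pair X Y = pair X' Y' \<longleftrightarrow> X = X' \<and> Y = Y'"
  by (metis proj1_pair proj2_pair)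

lemma tag_notin_pair: "PiTag \<notin> pair X Y" "SigTag \<notin> pair X Y"
  by (simp_all add: pair_def)

text \<open>Once the tag is removed, the projections recover the components. Inversion on
  \<open>type_per\<close> rests on this and on \<open>code_distinct\<close>.\<close>

lemma code_eq_iff [simp]:
  "pi_code A F = pi_code A' F' \<longleftrightarrow> A = A' \<and> F = F'"
  "sig_code A F = sig_code A' F' \<longleftrightarrow> A = A' \<and> F = F'"
  using tag_notin_pair by (simp_all add: pi_code_def sig_code_def insert_ident pair_eq_iff)

lemma code_distinct [simp]:
  "pi_code A F \<noteq> sig_code A' F'" "sig_code A' F' \<noteq> pi_code A F"
  "s \<noteq> PiTag \<Longrightarrow> pi_code A F \<noteq> {s}" "s \<noteq> PiTag \<Longrightarrow> {s} \<noteq> pi_code A F"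
  "s \<noteq> SigTag \<Longrightarrow> sig_code A F \<noteq> {s}" "s \<noteq> SigTag \<Longrightarrow> {s} \<noteq> sig_code A F"
proof -
  have "PiTag \<in> pi_code A F" "PiTag \<notin> sig_code A' F'" "SigTag \<in> sig_code A F" for A F A' F'
    by (simp_all add: pi_code_def sig_code_def tag_notin_pair)
  then show "pi_code A F \<noteq> sig_code A' F'" "sig_code A' F' \<noteq> pi_code A F"
    "s \<noteq> PiTag \<Longrightarrow> pi_code A F \<noteq> {s}" "s \<noteq> PiTag \<Longrightarrow> {s} \<noteq> pi_code A F"
    "s \<noteq> SigTag \<Longrightarrow> sig_code A F \<noteq> {s}" "s \<noteq> SigTag \<Longrightarrow> {s} \<noteq> sig_code A F"
    by (metis singletonD)+
qed

section \<open>Continuity in the environment, and the beta law\<close>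

definition fin_below :: "(nat \<Rightarrow> dom) \<Rightarrow> (nat \<Rightarrow> dom) \<Rightarrow> bool" where
  "fin_below \<rho>' \<rho> \<longleftrightarrow> \<rho>' \<le> \<rho> \<and> (\<forall>i. finite (\<rho>' i))"

text \<open>Scott continuity, with finite approximation meant coordinate by coordinate: infinitely
  many coordinates may be nonempty. This suffices because the beta law and the final argument
  extract finite data from coordinate 0 only.\<close>

definition cont :: "((nat \<Rightarrow> dom) \<Rightarrow> dom) \<Rightarrow> bool" where
  "cont G \<longleftrightarrow> mono G \<and> (\<forall>\<rho> b. b \<in> G \<rho> \<longrightarrow> (\<exists>\<rho>'. fin_below \<rho>' \<rho> \<and> b \<in> G \<rho>'))"

lemma contI:
  assumes "\<And>\<rho> \<rho>' b. \<rho> \<le> \<rho>' \<Longrightarrow> b \<in> G \<rho> \<Longrightarrow> b \<in> G \<rho>'"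
    and "\<And>\<rho> b. b \<in> G \<rho> \<Longrightarrow> \<exists>\<rho>'. fin_below \<rho>' \<rho> \<and> b \<in> G \<rho>'"
  shows "cont G"
  using assms unfolding cont_def by (auto intro!: monoI)

lemma cont_monoD: "cont G \<Longrightarrow> \<rho> \<le> \<rho>' \<Longrightarrow> G \<rho> \<subseteq> G \<rho>'"
  unfolding cont_def by (blast dest: monoD)

lemma cont_finD: "cont G \<Longrightarrow> b \<in> G \<rho> \<Longrightarrow> \<exists>\<rho>'. fin_below \<rho>' \<rho> \<and> b \<in> G \<rho>'"
  unfolding cont_def by blast

lemma fin_below_sup: "fin_below \<rho>1 \<rho> \<Longrightarrow> fin_below \<rho>2 \<rho> \<Longrightarrow> fin_below (sup \<rho>1 \<rho>2) \<rho>"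
  unfolding fin_below_def by simp

lemma fin_below_empty: "fin_below (\<lambda>i. {}) \<rho>"
  unfolding fin_below_def by (simp add: le_fun_def)

text \<open>Approximations are directed: those for the individual tokens are joined by
  \<open>sup\<close>.\<close>

lemma cont_finite:
  assumes "cont G" "finite S" "S \<subseteq> G \<rho>"
  shows "\<exists>\<rho>'. fin_below \<rho>' \<rho> \<and> S \<subseteq> G \<rho>'"
  using assms(2,3)
proof (induction S rule: finite_induct)
  case empty
  then show ?case using fin_below_empty by blast
next
  case (insert b S)
  then obtain \<rho>1 where 1: "fin_below \<rho>1 \<rho>" "S \<subseteq> G \<rho>1" by auto
  obtain \<rho>2 where 2: "fin_below \<rho>2 \<rho>" "b \<in> G \<rho>2"
    using cont_finD[OF assms(1)] insert.prems by blast
  have "G \<rho>1 \<subseteq> G (sup \<rho>1 \<rho>2)" "G \<rho>2 \<subseteq> G (sup \<rho>1 \<rho>2)"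
    by (rule cont_monoD[OF assms(1)], simp)+
  then have "insert b S \<subseteq> G (sup \<rho>1 \<rho>2)" using 1 2 by blast
  then show ?case using fin_below_sup[OF 1(1) 2(1)] by blast
qed

lemma cont_const: "cont (\<lambda>\<rho>. X)"
  by (rule contI) (use fin_below_empty in blast)+

lemma cont_var: "cont (\<lambda>\<rho>. \<rho> i)"
proof (rule contI)
  fix \<rho> :: "nat \<Rightarrow> dom" and b assume "b \<in> \<rho> i"
  then have "fin_below ((\<lambda>j. {})(i := {b})) \<rho> \<and> b \<in> ((\<lambda>j. {})(i := {b})) i"
    by (simp add: fin_below_def le_fun_def)
  then show "\<exists>\<rho>'. fin_below \<rho>' \<rho> \<and> b \<in> \<rho>' i" by blast
qed (auto simp: le_fun_def)

text \<open>The basic closure property, since application, projections, successor and recursion are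
  unions over the tokens of an argument. A token of the output needs one token \<open>s\<close> of
  \<open>H\<close> and one approximation for \<open>K s\<close>.\<close>

lemma cont_UN:
  assumes "cont H" "\<And>s. cont (K s)"
  shows "cont (\<lambda>\<rho>. \<Union>s\<in>H \<rho>. K s \<rho>)"
proof (rule contI)
  fix \<rho> \<rho>' :: "nat \<Rightarrow> dom" and b
  assume "\<rho> \<le> \<rho>'" "b \<in> (\<Union>s\<in>H \<rho>. K s \<rho>)"
  then show "b \<in> (\<Union>s\<in>H \<rho>'. K s \<rho>')"
    using cont_monoD[OF assms(1), of \<rho> \<rho>'] cont_monoD[OF assms(2), of \<rho> \<rho>'] by auto
next
  fix \<rho> b assume "b \<in> (\<Union>s\<in>H \<rho>. K s \<rho>)"
  then obtain s where s: "s \<in> H \<rho>" "b \<in> K s \<rho>" by blast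
  obtain \<rho>1 where 1: "fin_below \<rho>1 \<rho>" "s \<in> H \<rho>1" using cont_finD[OF assms(1) s(1)] by blast
  obtain \<rho>2 where 2: "fin_below \<rho>2 \<rho>" "b \<in> K s \<rho>2" using cont_finD[OF assms(2) s(2)] by blast
  have "H \<rho>1 \<subseteq> H (sup \<rho>1 \<rho>2)" "K s \<rho>2 \<subseteq> K s (sup \<rho>1 \<rho>2)"
    by (rule cont_monoD[OF assms(1)], simp) (rule cont_monoD[OF assms(2)], simp)
  then show "\<exists>\<rho>'. fin_below \<rho>' \<rho> \<and> b \<in> (\<Union>s\<in>H \<rho>'. K s \<rho>')"
    using 1 2 fin_below_sup[OF 1(1) 2(1)] by blast
qed

lemma cont_Un: "cont G \<Longrightarrow> cont H \<Longrightarrow> cont (\<lambda>\<rho>. G \<rho> \<union> H \<rho>)"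
  \<comment> \<open>\<open>Zer\<close> and \<open>One\<close> only serve as two distinct indices for
    a binary union.\<close>
  using cont_UN[where H = "\<lambda>\<rho>. {Zer, One}" and K = "\<lambda>s. if s = Zer then G else H"]
  by (simp add: cont_const)

text \<open>The guard is the test that \<open>Fn xs b\<close> makes in an application; being finite,
  it is already passed by an approximation.\<close>

lemma cont_guard:
  assumes "cont G" "finite S"
  shows "cont (\<lambda>\<rho>. if S \<subseteq> G \<rho> then X else {})"
proof (rule contI)
  fix \<rho> \<rho>' :: "nat \<Rightarrow> dom" and b
  assume "\<rho> \<le> \<rho>'" "b \<in> (if S \<subseteq> G \<rho> then X else {})"
  then show "b \<in> (if S \<subseteq> G \<rho>' then X else {})"
    using cont_monoD[OF assms(1), of \<rho> \<rho>'] by (auto split: if_splits)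
next
  fix \<rho> b assume "b \<in> (if S \<subseteq> G \<rho> then X else {})"
  then have "S \<subseteq> G \<rho>" "b \<in> X" by (auto split: if_splits)
  from cont_finite[OF assms this(1)] \<open>b \<in> X\<close>
  show "\<exists>\<rho>'. fin_below \<rho>' \<rho> \<and> b \<in> (if S \<subseteq> G \<rho>' then X else {})" by auto
qed

lemma cont_app:
  assumes "cont G" "cont H"
  shows "cont (\<lambda>\<rho>. app (G \<rho>) (H \<rho>))"
  unfolding app_def
proof (rule cont_UN[OF assms(1)])
  fix s
  show "cont (\<lambda>\<rho>. case s of Fn xs b \<Rightarrow> if set xs \<subseteq> H \<rho> then {b} else {} | Err \<Rightarrow> {Err} | _ \<Rightarrow> {})"
    by (cases s) (simp_all add: cont_const cont_guard[OF assms(2)])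
qed

lemma cont_pair: "cont G \<Longrightarrow> cont H \<Longrightarrow> cont (\<lambda>\<rho>. pair (G \<rho>) (H \<rho>))"
  unfolding pair_def by (intro cont_Un cont_UN cont_const)

lemma cont_proj1: "cont G \<Longrightarrow> cont (\<lambda>\<rho>. proj1 (G \<rho>))"
  unfolding proj1_def by (intro cont_UN cont_const)

lemma cont_proj2: "cont G \<Longrightarrow> cont (\<lambda>\<rho>. proj2 (G \<rho>))"
  unfolding proj2_def by (intro cont_UN cont_const)

lemma cont_succ: "cont G \<Longrightarrow> cont (\<lambda>\<rho>. succ (G \<rho>))"
  unfolding succ_def by (intro cont_UN cont_const)

lemma cont_tok_rec:
  assumes "cont A" "cont B" "cont G"
  shows "cont (\<lambda>\<rho>. tok_rec (A \<rho>) (B \<rho>) (G \<rho>) s)"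
  by (induction s) (simp_all add: assms cont_const cont_app)

lemma cont_shift:
  assumes "cont G"
  shows "cont (\<lambda>\<rho>. G (\<lambda>i. \<rho> (Suc i)))"
proof (rule contI)
  fix \<rho> \<rho>' :: "nat \<Rightarrow> dom" and b
  assume "\<rho> \<le> \<rho>'" "b \<in> G (\<lambda>i. \<rho> (Suc i))"
  moreover from this(1) have "(\<lambda>i. \<rho> (Suc i)) \<le> (\<lambda>i. \<rho>' (Suc i))" by (simp add: le_fun_def)
  ultimately show "b \<in> G (\<lambda>i. \<rho>' (Suc i))" using cont_monoD[OF assms] by blast
next
  fix \<rho> :: "nat \<Rightarrow> dom" and b assume "b \<in> G (\<lambda>i. \<rho> (Suc i))"
  from cont_finD[OF assms this] obtain \<rho>1 where 1: "fin_below \<rho>1 (\<lambda>i. \<rho> (Suc i))" "b \<in> G \<rho>1" by blast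
  then have "fin_below (case_nat {} \<rho>1) \<rho> \<and> b \<in> G (\<lambda>i. case_nat {} \<rho>1 (Suc i))"
    by (auto simp: fin_below_def le_fun_def split: nat.split)
  then show "\<exists>\<rho>'. fin_below \<rho>' \<rho> \<and> b \<in> G (\<lambda>i. \<rho>' (Suc i))" by blast
qed

lemma case_nat_mono: "\<rho> \<le> \<rho>' \<Longrightarrow> X \<subseteq> X' \<Longrightarrow> case_nat X \<rho> \<le> case_nat X' (\<rho>' :: nat \<Rightarrow> dom)"
  by (auto simp: le_fun_def split: nat.split)

lemma cont_lam:
  assumes "cont G"
  shows "cont (\<lambda>\<rho>. lam (\<lambda>x. G (case_nat x \<rho>)))"
proof (rule contI)
  fix \<rho> \<rho>' :: "nat \<Rightarrow> dom" and b
  assume "\<rho> \<le> \<rho>'" "b \<in> lam (\<lambda>x. G (case_nat x \<rho>))"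
  then show "b \<in> lam (\<lambda>x. G (case_nat x \<rho>'))"
    using cont_monoD[OF assms case_nat_mono, of \<rho> \<rho>'] unfolding lam_def by blast
next
  fix \<rho> :: "nat \<Rightarrow> dom" and b assume "b \<in> lam (\<lambda>x. G (case_nat x \<rho>))"
  then obtain xs c where b: "b = Fn xs c" "c \<in> G (case_nat (set xs) \<rho>)" by (auto simp: lam_def)
  from cont_finD[OF assms b(2)] obtain \<rho>1
    where 1: "fin_below \<rho>1 (case_nat (set xs) \<rho>)" "c \<in> G \<rho>1" by blast
  let ?\<rho> = "\<lambda>i. \<rho>1 (Suc i)"
  have le: "\<rho>1 i \<subseteq> case_nat (set xs) \<rho> i" for i using 1(1) by (simp add: fin_below_def le_fun_def)
  have "\<rho>1 \<le> case_nat (set xs) ?\<rho>"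
    using le[of 0] by (auto simp: le_fun_def split: nat.split)
  then have "c \<in> G (case_nat (set xs) ?\<rho>)" using 1(2) cont_monoD[OF assms] by auto
  moreover have "fin_below ?\<rho> \<rho>"
    using 1(1) le[of "Suc _"] by (auto simp: fin_below_def le_fun_def)
  ultimately show "\<exists>\<rho>'. fin_below \<rho>' \<rho> \<and> b \<in> lam (\<lambda>x. G (case_nat x \<rho>'))"
    using b(1) by (auto simp: lam_def)
qed

text \<open>The beta law of the model, where continuity is essential: a token of the body at
  \<open>y\<close> uses only finitely many tokens of \<open>y\<close>, and listing these gives a
  step \<open>Fn xs b\<close> of the graph.\<close>

lemma app_lam_cont:
  assumes "cont G"
  shows "app (lam (\<lambda>x. G (case_nat x \<rho>))) y = G (case_nat y \<rho>)"
proof (rule set_eqI)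
  fix b
  show "b \<in> app (lam (\<lambda>x. G (case_nat x \<rho>))) y \<longleftrightarrow> b \<in> G (case_nat y \<rho>)"
  proof
    assume "b \<in> app (lam (\<lambda>x. G (case_nat x \<rho>))) y"
    then obtain xs where "b \<in> G (case_nat (set xs) \<rho>)" "set xs \<subseteq> y"
      by (auto simp: in_app_iff lam_def)
    then show "b \<in> G (case_nat y \<rho>)"
      by (rule cont_monoD[OF assms case_nat_mono[OF order_refl], THEN subsetD, rotated])
  next
    assume "b \<in> G (case_nat y \<rho>)"
    from cont_finD[OF assms this] obtain \<rho>1
      where 1: "fin_below \<rho>1 (case_nat y \<rho>)" "b \<in> G \<rho>1" by blast
    then obtain xs where xs: "set xs = \<rho>1 0" using finite_list[of "\<rho>1 0"] by (auto simp: fin_below_def)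
    have le: "\<rho>1 i \<subseteq> case_nat y \<rho> i" for i using 1(1) by (simp add: fin_below_def le_fun_def)
    have "\<rho>1 \<le> case_nat (set xs) \<rho>"
      using le[of "Suc _"] by (auto simp: xs le_fun_def split: nat.split)
    then have "b \<in> G (case_nat (set xs) \<rho>)" using 1(2) cont_monoD[OF assms] by auto
    moreover have "set xs \<subseteq> y" using xs le[of 0] by simp
    ultimately show "b \<in> app (lam (\<lambda>x. G (case_nat x \<rho>))) y"
      by (auto simp: in_app_iff lam_def)
  qed
qed

lemma cont_elim:
  assumes "cont A" "cont B" "cont G" "cont H"
  shows "cont (\<lambda>\<rho>. elim (A \<rho>) (B \<rho>) (G \<rho>) (H \<rho>))"
  unfolding elim_def by (intro cont_UN cont_tok_rec assms)

lemma cont_lam_elim: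
  assumes "cont A" "cont B" "cont G"
  shows "cont (\<lambda>\<rho>. lam (elim (A \<rho>) (B \<rho>) (G \<rho>)))"
  \<comment> \<open>The parameters do not mention the bound variable, so they are read in the
    shifted environment.\<close>
  using cont_lam[OF cont_elim[OF assms[THEN cont_shift] cont_var[of 0]]] by simp

lemma app_lam_elim [simp]: "app (lam (elim a b g)) x = elim a b g x"
  using app_lam_cont[OF cont_elim[OF cont_const cont_const cont_const cont_var[of 0]]] by simp

lemma cont_den: "cont (den t)"
proof (induction t)
  case (PiT A B)
  then show ?case unfolding den.simps(7) pi_code_def by (intro cont_Un cont_const cont_pair cont_lam)
next
  case (SigT A B)
  then show ?case unfolding den.simps(8) sig_code_def by (intro cont_Un cont_const cont_pair cont_lam)
qed (simp_all add: cont_const cont_var cont_lam cont_app cont_pair cont_proj1 cont_proj2 cont_succ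
    cont_lam_elim)

lemma app_den_lam [simp]: "app (lam (\<lambda>x. den t (case_nat x \<rho>))) y = den t (case_nat y \<rho>)"
  by (rule app_lam_cont[OF cont_den])

section \<open>Renaming and substitution\<close>

lemma den_ren [simp]: "den (ren r t) \<rho> = den t (\<lambda>i. \<rho> (r i))"
proof -
  have up: "(\<lambda>i. case_nat x \<rho> (up_ren r i)) = case_nat x (\<lambda>i. \<rho> (r i))"
    for r x and \<rho> :: "nat \<Rightarrow> dom"
    by (rule ext) (simp add: up_ren_def split: nat.split)
  show ?thesis by (induction t arbitrary: r \<rho>) (simp_all add: up)
qed

lemma den_subst: "den (subst s t) \<rho> = den t (\<lambda>i. den (s i) \<rho>)"
proof -
  have up: "(\<lambda>i. den (up s i) (case_nat x \<rho>)) = case_nat x (\<lambda>i. den (s i) \<rho>)" for s x \<rho>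
    by (rule ext) (simp add: up_def split: nat.split)
  show ?thesis by (induction t arbitrary: s \<rho>) (simp_all add: up)
qed

lemma den_inst [simp]: "den (F\<lbrakk>a\<rbrakk>) \<rho> = den F (case_nat (den a \<rho>) \<rho>)"
proof -
  have "(\<lambda>i. den (case_nat a Var i) \<rho>) = case_nat (den a \<rho>) \<rho>"
    by (rule ext) (simp split: nat.split)
  then show ?thesis by (simp add: inst_def den_subst)
qed

lemma den_inst_succ [simp]:
  "den (inst_succ F) \<rho> = den F (case_nat (succ (\<rho> 0)) (\<lambda>i. \<rho> (Suc i)))"
proof -
  have "(\<lambda>i. den (case_nat (TSucc (Var 0)) (\<lambda>i. Var (Suc i)) i) \<rho>)
      = case_nat (succ (\<rho> 0)) (\<lambda>i. \<rho> (Suc i))"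
    by (rule ext) (simp split: nat.split)
  then show ?thesis by (simp add: inst_succ_def den_subst)
qed

section \<open>Types as partial equivalence relations\<close>

type_synonym per = "dom \<Rightarrow> dom \<Rightarrow> bool"

text \<open>
  The worlds are \<open>True\<close>, where \<open>N0\<close> is empty, and \<open>False \<le> True\<close>, where the exception inhabits every type.
\<close>

inductive atom_tok :: "bool \<Rightarrow> atom \<Rightarrow> tok \<Rightarrow> bool" where
  "atom_tok w AtN1 Zer"
| "atom_tok w AtN2 Zer"
| "atom_tok w AtN2 One"
| "atom_tok w AtN Zer"
| "atom_tok w AtN s \<Longrightarrow> atom_tok w AtN (Su s)"
| "atom_tok False c Err"

text \<open>Base types are discrete and their elements are single tokens. At world
  \<open>False\<close> the numbers include not only \<open>Err\<close> but also
  \<open>Su Err\<close> and so on.\<close>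

definition atom_per :: "bool \<Rightarrow> atom \<Rightarrow> per" where
  "atom_per w c x y \<longleftrightarrow> (\<exists>s. atom_tok w c s \<and> x = {s} \<and> y = {s})"

text \<open>The quantification over \<open>v \<le> w\<close> is Kripke-style and makes functions
  persist from the actual to the potential world. The family is indexed by the left argument
  \<open>a\<close>; by \<open>family_props\<close> a related argument gives the same
  relation.\<close>

definition pi_per :: "bool \<Rightarrow> (bool \<Rightarrow> per) \<Rightarrow> (bool \<Rightarrow> dom \<Rightarrow> per) \<Rightarrow> per" where
  "pi_per w RA RB f g \<longleftrightarrow> (\<forall>v\<le>w. \<forall>a b. RA v a b \<longrightarrow> RB v a (app f a) (app g b))"

definition sig_per :: "bool \<Rightarrow> (bool \<Rightarrow> per) \<Rightarrow> (bool \<Rightarrow> dom \<Rightarrow> per) \<Rightarrow> per" where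
  "sig_per w RA RB p q \<longleftrightarrow> RA w (proj1 p) (proj1 q) \<and> RB w (proj1 p) (proj2 p) (proj2 q)"

text \<open>
  \<open>type_per V w A B R\<close>: at world \<open>w\<close> the codes \<open>A\<close> and \<open>B\<close> are equal types, whose elements are
  related by \<open>R\<close>. The parameter \<open>V\<close> is the relation on the elements of the universe, if there is one.
\<close>

inductive type_per :: "(bool \<Rightarrow> per) option \<Rightarrow> bool \<Rightarrow> dom \<Rightarrow> dom \<Rightarrow> per \<Rightarrow> bool" for V where
  atom: "type_per V w {Atm c} {Atm c} (atom_per w c)"
| raise: "type_per V False {Err} {Err} (\<lambda>_ _. True)"
| univ: "V = Some Q \<Longrightarrow> type_per V w {Unv} {Unv} (Q w)"
| pi: "(\<And>v. v \<le> w \<Longrightarrow> type_per V v A A' (RA v)) \<Longrightarrow>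
    (\<And>v a b. v \<le> w \<Longrightarrow> RA v a b \<Longrightarrow> type_per V v (app F a) (app F' b) (RB v a)) \<Longrightarrow>
    type_per V w (pi_code A F) (pi_code A' F') (pi_per w RA RB)"
| sig: "(\<And>v. v \<le> w \<Longrightarrow> type_per V v A A' (RA v)) \<Longrightarrow>
    (\<And>v a b. v \<le> w \<Longrightarrow> RA v a b \<Longrightarrow> type_per V v (app F a) (app F' b) (RB v a)) \<Longrightarrow>
    type_per V w (sig_code A F) (sig_code A' F') (sig_per w RA RB)"

section \<open>Inversion, determinacy and cumulativity\<close>

lemma pi_per_cong:
  assumes "\<And>v. v \<le> w \<Longrightarrow> RA v = RA' v" "\<And>v a b. v \<le> w \<Longrightarrow> RA v a b \<Longrightarrow> RB v a = RB' v a"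
  shows "pi_per w RA RB = pi_per w RA' RB'"
  using assms unfolding pi_per_def fun_eq_iff by metis

lemma sig_per_cong:
  assumes "\<And>v. v \<le> w \<Longrightarrow> RA v = RA' v" "\<And>v a b. v \<le> w \<Longrightarrow> RA v a b \<Longrightarrow> RB v a = RB' v a"
  shows "sig_per w RA RB = sig_per w RA' RB'"
  using assms unfolding sig_per_def fun_eq_iff by (metis order_refl)

lemma type_per_pi_cases:
  assumes "type_per V w (pi_code A F) C R"
  obtains A' F' RA RB where "C = pi_code A' F'" "R = pi_per w RA RB"
    "\<And>v. v \<le> w \<Longrightarrow> type_per V v A A' (RA v)"
    "\<And>v a b. v \<le> w \<Longrightarrow> RA v a b \<Longrightarrow> type_per V v (app F a) (app F' b) (RB v a)"
  using assms by cases auto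

lemma type_per_sig_cases:
  assumes "type_per V w (sig_code A F) C R"
  obtains A' F' RA RB where "C = sig_code A' F'" "R = sig_per w RA RB"
    "\<And>v. v \<le> w \<Longrightarrow> type_per V v A A' (RA v)"
    "\<And>v a b. v \<le> w \<Longrightarrow> RA v a b \<Longrightarrow> type_per V v (app F a) (app F' b) (RB v a)"
  using assms by cases auto

lemma type_per_atom_cases:
  "type_per V w {Atm c} C R \<Longrightarrow> C = {Atm c} \<and> R = atom_per w c"
  by (erule type_per.cases) auto

lemma type_per_univ_cases:
  "type_per V w {Unv} C R \<Longrightarrow> C = {Unv} \<and> (\<exists>Q. V = Some Q \<and> R = Q w)"
  by (erule type_per.cases) auto

lemma type_per_raise_cases:
  "type_per V w {Err} C R \<Longrightarrow> C = {Err} \<and> R = (\<lambda>_ _. True)"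
  by (erule type_per.cases) auto

text \<open>The shape of the left code fixes the rule, and induction fixes the relations of the
  components. So the inductive relation behaves like a definition of the elements by recursion on
  types.\<close>

lemma type_per_functional: "type_per V w A B R \<Longrightarrow> type_per V w A C R' \<Longrightarrow> R = R'"
proof (induction arbitrary: C R' rule: type_per.induct)
  case (pi w A A' RA F F' RB)
  from pi.prems obtain A1 F1 RA1 RB1 where R': "R' = pi_per w RA1 RB1"
    and 1: "\<And>v. v \<le> w \<Longrightarrow> type_per V v A A1 (RA1 v)"
    and 2: "\<And>v a b. v \<le> w \<Longrightarrow> RA1 v a b \<Longrightarrow> type_per V v (app F a) (app F1 b) (RB1 v a)"
    by (rule type_per_pi_cases) blast
  have eq: "RA v = RA1 v" if "v \<le> w" for v using pi.IH(1)[OF that 1[OF that]] .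
  show ?case unfolding R'
    by (rule pi_per_cong) (use eq pi.IH(2) 2 in \<open>metis+\<close>)
next
  case (sig w A A' RA F F' RB)
  from sig.prems obtain A1 F1 RA1 RB1 where R': "R' = sig_per w RA1 RB1"
    and 1: "\<And>v. v \<le> w \<Longrightarrow> type_per V v A A1 (RA1 v)"
    and 2: "\<And>v a b. v \<le> w \<Longrightarrow> RA1 v a b \<Longrightarrow> type_per V v (app F a) (app F1 b) (RB1 v a)"
    by (rule type_per_sig_cases) blast
  have eq: "RA v = RA1 v" if "v \<le> w" for v using sig.IH(1)[OF that 1[OF that]] .
  show ?case unfolding R'
    by (rule sig_per_cong) (use eq sig.IH(2) 2 in \<open>metis+\<close>)
qed (auto dest: type_per_atom_cases type_per_univ_cases type_per_raise_cases)

lemma type_per_lift: "type_per None w A B R \<Longrightarrow> type_per V w A B R"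
  by (induction rule: type_per.induct) (auto intro: type_per.intros)

lemma atom_tok_antimono: "atom_tok w c s \<Longrightarrow> v \<le> w \<Longrightarrow> atom_tok v c s"
  by (induction rule: atom_tok.induct) (auto intro: atom_tok.intros)

section \<open>Equality of types and of elements, for any admissible universe relation\<close>

definition type_eq :: "(bool \<Rightarrow> per) option \<Rightarrow> bool \<Rightarrow> dom \<Rightarrow> dom \<Rightarrow> bool" where
  "type_eq V w A B \<longleftrightarrow> (\<exists>R. type_per V w A B R)"

definition elem_eq :: "(bool \<Rightarrow> per) option \<Rightarrow> bool \<Rightarrow> dom \<Rightarrow> dom \<Rightarrow> dom \<Rightarrow> bool" where
  "elem_eq V w A x y \<longleftrightarrow> (\<exists>R. type_per V w A A R \<and> R x y)"

text \<open>Shared by the levels below and above the universe; the assumptions are what the rule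
  \<open>univ\<close> demands in the inductions on \<open>type_per\<close>.\<close>

locale per_model =
  fixes V :: "(bool \<Rightarrow> per) option"
  assumes univ_symp: "V = Some Q \<Longrightarrow> symp (Q w)"
    and univ_transp: "V = Some Q \<Longrightarrow> transp (Q w)"
    and univ_antimono: "V = Some Q \<Longrightarrow> v \<le> w \<Longrightarrow> Q w \<le> Q v"
    and univ_raise: "V = Some Q \<Longrightarrow> Q False {Err} {Err}"
begin

abbreviation TP where "TP \<equiv> type_per V"
abbreviation teq where "teq \<equiv> type_eq V"
abbreviation eeq where "eeq \<equiv> elem_eq V"

text \<open>For related \<open>a\<close> and \<open>b\<close>, the code \<open>app F' b\<close> is
  the left code of derivations for both \<open>S a\<close> and \<open>S b\<close>, so the two
  relations agree by determinacy.\<close>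

lemma family_props:
  assumes A: "TP v A' A R" "symp R" "transp R"
    and F: "\<And>a b. R a b \<Longrightarrow> TP v (app F a) (app F' b) (S a)"
    and F': "\<And>a b. R a b \<Longrightarrow> TP v (app F' b) (app F a) (S a) \<and> symp (S a) \<and> transp (S a)"
  shows "R a b \<Longrightarrow> S a = S b"
    and "R a b \<Longrightarrow> TP v (app F' a) (app F b) (S a)"
proof -
  show eq: "S a = S b" if "R a b" for a b
  proof -
    have "R b b" using that A(2,3) by (meson sympD transpD)
    then show ?thesis using F' that type_per_functional by blast
  qed
  show "TP v (app F' a) (app F b) (S a)" if "R a b"
    using F'[of b a] eq[OF that] that A(2) by (auto dest: sympD)
qed

text \<open>The three claims are proved together: reversing a derivation for a family requires its
  relations to agree at related arguments, which by \<open>family_props\<close> takes the reversed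
  derivations and the symmetry of the domain.\<close>

lemma type_per_sym_per: "TP w A B R \<Longrightarrow> TP w B A R \<and> symp R \<and> transp R"
proof (induction rule: type_per.induct)
  case (atom w c)
  then show ?case
    by (intro conjI type_per.atom sympI transpI) (auto simp: atom_per_def)
next
  case raise
  then show ?case by (intro conjI type_per.raise sympI transpI)
next
  case (univ Q w)
  then show ?case by (intro conjI type_per.univ univ_symp univ_transp)
next
  case (pi w A A' RA F F' RB)
  note IH1 = pi.IH(1)[THEN conjunct1] pi.IH(1)[THEN conjunct2, THEN conjunct1]
    pi.IH(1)[THEN conjunct2, THEN conjunct2]
  note fam = family_props[OF IH1 pi.hyps(2) pi.IH(2)]
  have "TP w (pi_code A' F') (pi_code A F) (pi_per w RA RB)"
    by (rule type_per.pi) (use IH1 fam in auto)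
  moreover have "symp (pi_per w RA RB)"
    using IH1(2) pi.IH(2) fam(1) unfolding symp_def pi_per_def by metis
  moreover have "transp (pi_per w RA RB)"
  proof (rule transpI)
    fix f g h assume fg: "pi_per w RA RB f g" and gh: "pi_per w RA RB g h"
    show "pi_per w RA RB f h" unfolding pi_per_def
    proof (intro allI impI)
      fix v a b assume v: "v \<le> w" and ab: "RA v a b"
      \<comment> \<open>The first equation is taken at \<open>a, a\<close>, so that both equations
        lie over \<open>a\<close> and meet in \<open>app g a\<close>.\<close>
      have aa: "RA v a a" using ab IH1(2,3)[OF v] by (meson sympD transpD)
      have "RB v a (app f a) (app g a)" "RB v a (app g a) (app h b)"
        using fg gh v ab aa unfolding pi_per_def by blast+
      then show "RB v a (app f a) (app h b)" using pi.IH(2)[OF v ab] by (meson transpD)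
    qed
  qed
  ultimately show ?case by blast
next
  case (sig w A A' RA F F' RB)
  note IH1 = sig.IH(1)[THEN conjunct1] sig.IH(1)[THEN conjunct2, THEN conjunct1]
    sig.IH(1)[THEN conjunct2, THEN conjunct2]
  note fam = family_props[OF IH1 sig.hyps(2) sig.IH(2)]
  have "TP w (sig_code A' F') (sig_code A F) (sig_per w RA RB)"
    by (rule type_per.sig) (use IH1 fam in auto)
  moreover have "symp (sig_per w RA RB)"
  proof (rule sympI)
    fix p q assume pq: "sig_per w RA RB p q"
    \<comment> \<open>After the swap the second components are compared over \<open>proj1 q\<close>
      instead of \<open>proj1 p\<close>.\<close>
    then have "RB w (proj1 p) = RB w (proj1 q)" using fam(1) by (simp add: sig_per_def)
    then show "sig_per w RA RB q p"
      using pq IH1(2)[OF order_refl] sig.IH(2)[OF order_refl] unfolding sig_per_def by (metis sympD)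
  qed
  moreover have "transp (sig_per w RA RB)"
  proof (rule transpI)
    fix p q r assume pq: "sig_per w RA RB p q" and qr: "sig_per w RA RB q r"
    then have "RB w (proj1 p) = RB w (proj1 q)" using fam(1) by (simp add: sig_per_def)
    then show "sig_per w RA RB p r"
      using pq qr IH1(3)[OF order_refl] sig.IH(2)[OF order_refl] unfolding sig_per_def by (metis transpD)
  qed
  ultimately show ?case by blast
qed

lemma type_per_sym: "TP w A B R \<Longrightarrow> TP w B A R"
  and type_per_symp: "TP w A B R \<Longrightarrow> symp R"
  and type_per_transp: "TP w A B R \<Longrightarrow> transp R"
  using type_per_sym_per by blast+

lemma type_per_elem_refl: "TP w A B R \<Longrightarrow> R a b \<Longrightarrow> R a a \<and> R b b"
  using type_per_symp type_per_transp by (meson sympD transpD)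

lemma type_per_trans: "TP w A B R \<Longrightarrow> TP w B C R' \<Longrightarrow> TP w A C R"
proof (induction arbitrary: C R' rule: type_per.induct)
  case (pi w A A' RA F F' RB)
  from pi.prems obtain A1 F1 RA1 RB1 where C: "C = pi_code A1 F1"
    and 1: "\<And>v. v \<le> w \<Longrightarrow> TP v A' A1 (RA1 v)"
    and 2: "\<And>v a b. v \<le> w \<Longrightarrow> RA1 v a b \<Longrightarrow> TP v (app F' a) (app F1 b) (RB1 v a)"
    by (rule type_per_pi_cases) blast
  have eq: "RA v = RA1 v" if "v \<le> w" for v
    using type_per_functional[OF type_per_sym[OF pi.hyps(1)] 1] that by blast
  show ?case unfolding C
  proof (rule type_per.pi)
    fix v a b assume v: "v \<le> w" and ab: "RA v a b"
    \<comment> \<open>The second derivation is taken at \<open>b, b\<close>, so that the composite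
      passes through \<open>app F' b\<close>.\<close>
    have "RA1 v b b" using type_per_elem_refl[OF pi.hyps(1)[OF v] ab] eq[OF v] by simp
    then show "TP v (app F a) (app F1 b) (RB v a)" using pi.IH(2)[OF v ab 2[OF v]] by blast
  qed (use pi.IH(1) 1 in blast)
next
  case (sig w A A' RA F F' RB)
  from sig.prems obtain A1 F1 RA1 RB1 where C: "C = sig_code A1 F1"
    and 1: "\<And>v. v \<le> w \<Longrightarrow> TP v A' A1 (RA1 v)"
    and 2: "\<And>v a b. v \<le> w \<Longrightarrow> RA1 v a b \<Longrightarrow> TP v (app F' a) (app F1 b) (RB1 v a)"
    by (rule type_per_sig_cases) blast
  have eq: "RA v = RA1 v" if "v \<le> w" for v
    using type_per_functional[OF type_per_sym[OF sig.hyps(1)] 1] that by blast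
  show ?case unfolding C
  proof (rule type_per.sig)
    fix v a b assume v: "v \<le> w" and ab: "RA v a b"
    have "RA1 v b b" using type_per_elem_refl[OF sig.hyps(1)[OF v] ab] eq[OF v] by simp
    then show "TP v (app F a) (app F1 b) (RB v a)" using sig.IH(2)[OF v ab 2[OF v]] by blast
  qed (use sig.IH(1) 1 in blast)
qed (auto dest!: type_per_atom_cases type_per_univ_cases type_per_raise_cases intro: type_per.intros)

text \<open>Actual equalities remain potential ones. For functions this is built into
  \<open>pi_per\<close>; for pairs the fibres at the two worlds are matched by determinacy.\<close>

lemma type_per_antimono: "TP w A B R \<Longrightarrow> v \<le> w \<Longrightarrow> \<exists>R'. TP v A B R' \<and> R \<le> R'"
proof (induction arbitrary: v rule: type_per.induct)
  case (atom w c)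
  have "atom_per w c \<le> atom_per v c"
    unfolding atom_per_def by (intro le_funI le_boolI) (use atom_tok_antimono[OF _ atom] in blast)
  then show ?case using type_per.atom by blast
next
  case raise
  then show ?case using type_per.raise by auto
next
  case (univ Q w)
  then show ?case using type_per.univ univ_antimono by blast
next
  case (pi w A A' RA F F' RB)
  have "TP v (pi_code A F) (pi_code A' F') (pi_per v RA RB)"
    by (rule type_per.pi) (use pi.hyps pi.prems order_trans in blast)+
  moreover have "pi_per w RA RB \<le> pi_per v RA RB"
    using pi.prems unfolding pi_per_def by (auto intro: order_trans)
  ultimately show ?case by blast
next
  case (sig w A A' RA F F' RB)
  have "TP v (sig_code A F) (sig_code A' F') (sig_per v RA RB)"
    by (rule type_per.sig) (use sig.hyps sig.prems order_trans in blast)+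
  moreover have "sig_per w RA RB \<le> sig_per v RA RB"
  proof (intro le_funI le_boolI)
    fix p q assume pq: "sig_per w RA RB p q"
    have A: "RA w \<le> RA v"
      using sig.IH(1)[OF order_refl sig.prems] type_per_functional[OF sig.hyps(1)[OF sig.prems]] by blast
    then have p1: "RA v (proj1 p) (proj1 q)" "RA w (proj1 p) (proj1 q)" using pq unfolding sig_per_def by auto
    have "RB w (proj1 p) \<le> RB v (proj1 p)"
      using sig.IH(2)[OF order_refl p1(2) sig.prems]
        type_per_functional[OF sig.hyps(2)[OF sig.prems p1(1)]] by blast
    then show "sig_per v RA RB p q" using p1 pq unfolding sig_per_def by auto
  qed
  ultimately show ?case by blast
qed

text \<open>Applying or projecting the exception gives the exception, so membership passes from the
  components to function and pair types. Base types have \<open>Err\<close> at world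
  \<open>False\<close> outright, the universe by \<open>univ_raise\<close>.\<close>

lemma type_per_raise: "TP w A B R \<Longrightarrow> \<not> w \<Longrightarrow> R {Err} {Err}"
proof (induction rule: type_per.induct)
  case (sig w A A' RA F F' RB)
  have "RA w {Err} {Err}" using sig.IH(1) sig.prems by blast
  moreover from this have "RB w {Err} {Err} {Err}" using sig.IH(2) sig.prems by blast
  ultimately show ?case by (simp add: sig_per_def)
qed (auto simp: atom_per_def pi_per_def univ_raise intro: atom_tok.intros)

text \<open>By determinacy the relation is always that of the diagonal at the left code, so from
  here on it need not be carried along.\<close>

lemma type_per_eq_elem: "TP w A B R \<Longrightarrow> R = eeq w A"
  unfolding elem_eq_def fun_eq_iff
  using type_per_functional type_per_trans type_per_sym by metis

lemma teq_sym: "teq w A B \<Longrightarrow> teq w B A"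
  unfolding type_eq_def using type_per_sym by blast

lemma teq_trans: "teq w A B \<Longrightarrow> teq w B C \<Longrightarrow> teq w A C"
  unfolding type_eq_def using type_per_trans by blast

lemma teq_antimono: "teq w A B \<Longrightarrow> v \<le> w \<Longrightarrow> teq v A B"
  unfolding type_eq_def using type_per_antimono by blast

lemma eeq_type: "eeq w A x y \<Longrightarrow> teq w A A"
  unfolding type_eq_def elem_eq_def by blast

lemma eeq_sym: "eeq w A x y \<Longrightarrow> eeq w A y x"
  unfolding elem_eq_def by (meson type_per_symp sympD)

lemma eeq_trans: "eeq w A x y \<Longrightarrow> eeq w A y z \<Longrightarrow> eeq w A x z"
  unfolding elem_eq_def by (metis type_per_transp transpD type_per_functional)

lemma eeq_conv: "teq w A B \<Longrightarrow> eeq w A x y \<Longrightarrow> eeq w B x y"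
  using type_per_eq_elem type_per_sym unfolding type_eq_def by metis

lemma eeq_antimono: "eeq w A x y \<Longrightarrow> v \<le> w \<Longrightarrow> eeq v A x y"
  unfolding elem_eq_def using type_per_antimono by blast

lemma eeq_raise: "teq False A A \<Longrightarrow> eeq False A {Err} {Err}"
  unfolding elem_eq_def type_eq_def using type_per_raise by blast

lemma teq_atom [simp]: "teq w {Atm c} {Atm c}"
  unfolding type_eq_def by (blast intro: type_per.atom)

lemma eeq_atom_iff: "eeq w {Atm c} x y \<longleftrightarrow> (\<exists>s. atom_tok w c s \<and> x = {s} \<and> y = {s})"
  unfolding elem_eq_def using type_per.atom[of V w c] type_per_atom_cases atom_per_def by metis

lemma type_per_eeqI: "teq w A B \<Longrightarrow> TP w A B (eeq w A)"
  unfolding type_eq_def using type_per_eq_elem by metis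

lemma type_per_pi_eeq:
  assumes "teq w A A'" "\<And>v a b. v \<le> w \<Longrightarrow> eeq v A a b \<Longrightarrow> teq v (app F a) (app F' b)"
  shows "TP w (pi_code A F) (pi_code A' F') (pi_per w (\<lambda>v. eeq v A) (\<lambda>v a. eeq v (app F a)))"
  by (rule type_per.pi) (use assms type_per_eeqI teq_antimono in blast)+

lemma type_per_sig_eeq:
  assumes "teq w A A'" "\<And>v a b. v \<le> w \<Longrightarrow> eeq v A a b \<Longrightarrow> teq v (app F a) (app F' b)"
  shows "TP w (sig_code A F) (sig_code A' F') (sig_per w (\<lambda>v. eeq v A) (\<lambda>v a. eeq v (app F a)))"
  by (rule type_per.sig) (use assms type_per_eeqI teq_antimono in blast)+

text \<open>With \<open>eeq_pi_iff\<close>, this turns the inductive clause into recursion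
  equations, the form in which soundness uses it.\<close>

lemma teq_pi_iff:
  "teq w (pi_code A F) (pi_code A' F') \<longleftrightarrow>
    teq w A A' \<and> (\<forall>v\<le>w. \<forall>a b. eeq v A a b \<longrightarrow> teq v (app F a) (app F' b))"
proof
  assume "teq w (pi_code A F) (pi_code A' F')"
  then obtain R where "TP w (pi_code A F) (pi_code A' F') R" unfolding type_eq_def by blast
  then obtain A1 F1 RA RB where "pi_code A' F' = pi_code A1 F1"
    and "\<And>v. v \<le> w \<Longrightarrow> TP v A A1 (RA v)"
    and "\<And>v a b. v \<le> w \<Longrightarrow> RA v a b \<Longrightarrow> TP v (app F a) (app F1 b) (RB v a)"
    by (rule type_per_pi_cases) blast
  then have 1: "\<And>v. v \<le> w \<Longrightarrow> TP v A A' (RA v)"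
    and 2: "\<And>v a b. v \<le> w \<Longrightarrow> RA v a b \<Longrightarrow> TP v (app F a) (app F' b) (RB v a)"
    by simp_all
  then show "teq w A A' \<and> (\<forall>v\<le>w. \<forall>a b. eeq v A a b \<longrightarrow> teq v (app F a) (app F' b))"
    unfolding type_eq_def using type_per_eq_elem[OF 1] by (metis order_refl)
qed (use type_per_pi_eeq type_eq_def in blast)

lemma teq_sig_iff:
  "teq w (sig_code A F) (sig_code A' F') \<longleftrightarrow>
    teq w A A' \<and> (\<forall>v\<le>w. \<forall>a b. eeq v A a b \<longrightarrow> teq v (app F a) (app F' b))"
proof
  assume "teq w (sig_code A F) (sig_code A' F')"
  then obtain R where "TP w (sig_code A F) (sig_code A' F') R" unfolding type_eq_def by blast
  then obtain A1 F1 RA RB where "sig_code A' F' = sig_code A1 F1"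
    and "\<And>v. v \<le> w \<Longrightarrow> TP v A A1 (RA v)"
    and "\<And>v a b. v \<le> w \<Longrightarrow> RA v a b \<Longrightarrow> TP v (app F a) (app F1 b) (RB v a)"
    by (rule type_per_sig_cases) blast
  then have 1: "\<And>v. v \<le> w \<Longrightarrow> TP v A A' (RA v)"
    and 2: "\<And>v a b. v \<le> w \<Longrightarrow> RA v a b \<Longrightarrow> TP v (app F a) (app F' b) (RB v a)"
    by simp_all
  then show "teq w A A' \<and> (\<forall>v\<le>w. \<forall>a b. eeq v A a b \<longrightarrow> teq v (app F a) (app F' b))"
    unfolding type_eq_def using type_per_eq_elem[OF 1] by (metis order_refl)
qed (use type_per_sig_eeq type_eq_def in blast)

lemma eeq_pi_iff:
  assumes "teq w (pi_code A F) (pi_code A' F')"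
  shows "eeq w (pi_code A F) f g \<longleftrightarrow>
    (\<forall>v\<le>w. \<forall>a b. eeq v A a b \<longrightarrow> eeq v (app F a) (app f a) (app g b))"
proof -
  have "TP w (pi_code A F) (pi_code A' F') (pi_per w (\<lambda>v. eeq v A) (\<lambda>v a. eeq v (app F a)))"
    by (rule type_per_pi_eeq) (use assms teq_pi_iff in blast)+
  from type_per_eq_elem[OF this, symmetric] show ?thesis by (simp only: pi_per_def)
qed

lemma eeq_sig_iff:
  assumes "teq w (sig_code A F) (sig_code A' F')"
  shows "eeq w (sig_code A F) p q \<longleftrightarrow>
    eeq w A (proj1 p) (proj1 q) \<and> eeq w (app F (proj1 p)) (proj2 p) (proj2 q)"
proof -
  have "TP w (sig_code A F) (sig_code A' F') (sig_per w (\<lambda>v. eeq v A) (\<lambda>v a. eeq v (app F a)))"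
    by (rule type_per_sig_eeq) (use assms teq_sig_iff in blast)+
  from type_per_eq_elem[OF this, symmetric] show ?thesis by (simp only: sig_per_def)
qed

end

section \<open>The two levels: small types, and types with a universe\<close>

interpretation small: per_model None
  by unfold_locales auto

text \<open>The universe is built in two passes: types without it come first, and their equality
  then becomes the relation of \<open>{Unv}\<close>.\<close>

definition large :: "(bool \<Rightarrow> per) option" where
  "large = Some (type_eq None)"

interpretation large: per_model large
proof
  fix Q :: "bool \<Rightarrow> per" and v w :: bool
  assume "large = Some Q"
  then have Q: "Q = type_eq None" by (simp add: large_def)
  show "symp (Q w)" unfolding Q by (rule sympI, rule small.teq_sym)
  show "transp (Q w)" unfolding Q by (rule transpI, rule small.teq_trans)
  show "v \<le> w \<Longrightarrow> Q w \<le> Q v" unfolding Q by (intro le_funI le_boolI) (rule small.teq_antimono)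
  show "Q False {Err} {Err}" unfolding Q type_eq_def using type_per.raise by blast
qed

lemma teq_lift: "type_eq None w A B \<Longrightarrow> type_eq V w A B"
  unfolding type_eq_def using type_per_lift by blast

lemma eeq_lift: "elem_eq None w A x y \<Longrightarrow> elem_eq V w A x y"
  unfolding elem_eq_def using type_per_lift by blast

lemma type_per_univ: "type_per large w {Unv} {Unv} (type_eq None w)"
  by (rule type_per.univ) (simp add: large_def)

lemma teq_univ [simp]: "type_eq large w {Unv} {Unv}"
  unfolding type_eq_def using type_per_univ[of w] by blast

lemma eeq_univ_iff: "elem_eq large w {Unv} A B \<longleftrightarrow> type_eq None w A B"
proof
  assume "elem_eq large w {Unv} A B"
  then obtain R where "type_per large w {Unv} {Unv} R" "R A B" unfolding elem_eq_def by blast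
  then show "type_eq None w A B" using type_per_functional[OF type_per_univ] by simp
next
  assume "type_eq None w A B"
  then show "elem_eq large w {Unv} A B" unfolding elem_eq_def using type_per_univ[of w] by blast
qed

section \<open>Soundness\<close>

abbreviation "teq \<equiv> type_eq large"
abbreviation "eeq \<equiv> elem_eq large"

section \<open>Semantic judgments and their structural rules\<close>

primrec env_eq :: "tm list \<Rightarrow> bool \<Rightarrow> (nat \<Rightarrow> dom) \<Rightarrow> (nat \<Rightarrow> dom) \<Rightarrow> bool" where
  "env_eq [] w \<rho> \<rho>' \<longleftrightarrow> True"
| "env_eq (A # \<Gamma>) w \<rho> \<rho>' \<longleftrightarrow> env_eq \<Gamma> w (\<lambda>i. \<rho> (Suc i)) (\<lambda>i. \<rho>' (Suc i)) \<and>
    eeq w (den A (\<lambda>i. \<rho> (Suc i))) (\<rho> 0) (\<rho>' 0)"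

primrec valid_ctx :: "tm list \<Rightarrow> bool" where
  "valid_ctx [] \<longleftrightarrow> True"
| "valid_ctx (A # \<Gamma>) \<longleftrightarrow> valid_ctx \<Gamma> \<and>
    (\<forall>w \<rho> \<rho>'. env_eq \<Gamma> w \<rho> \<rho>' \<longrightarrow> teq w (den A \<rho>) (den A \<rho>'))"

text \<open>A logical relation: the two sides are evaluated in related environments, at every world,
  so the diagonal says that \<open>A\<close> denotes a type and respects equality. Validity of the
  context is carried along as a presupposition.\<close>

definition sem_type :: "tm list \<Rightarrow> tm \<Rightarrow> tm \<Rightarrow> bool" where
  "sem_type \<Gamma> A B \<longleftrightarrow> valid_ctx \<Gamma> \<and>
    (\<forall>w \<rho> \<rho>'. env_eq \<Gamma> w \<rho> \<rho>' \<longrightarrow> teq w (den A \<rho>) (den B \<rho>'))"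

definition sem_term :: "tm list \<Rightarrow> tm \<Rightarrow> tm \<Rightarrow> tm \<Rightarrow> bool" where
  "sem_term \<Gamma> t u A \<longleftrightarrow> sem_type \<Gamma> A A \<and>
    (\<forall>w \<rho> \<rho>'. env_eq \<Gamma> w \<rho> \<rho>' \<longrightarrow> eeq w (den A \<rho>) (den t \<rho>) (den u \<rho>'))"

lemma env_eq_antimono: "env_eq \<Gamma> w \<rho> \<rho>' \<Longrightarrow> v \<le> w \<Longrightarrow> env_eq \<Gamma> v \<rho> \<rho>'"
  by (induction \<Gamma> arbitrary: \<rho> \<rho>') (auto intro: large.eeq_antimono simp del: le_bool_def)

lemma env_eq_sym: "valid_ctx \<Gamma> \<Longrightarrow> env_eq \<Gamma> w \<rho> \<rho>' \<Longrightarrow> env_eq \<Gamma> w \<rho>' \<rho>"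
proof (induction \<Gamma> arbitrary: \<rho> \<rho>')
  case (Cons A \<Gamma>)
  let ?\<rho> = "\<lambda>i. \<rho> (Suc i)" and ?\<rho>' = "\<lambda>i. \<rho>' (Suc i)"
  have e: "env_eq \<Gamma> w ?\<rho> ?\<rho>'" and x: "eeq w (den A ?\<rho>) (\<rho> 0) (\<rho>' 0)"
    and A: "teq w (den A ?\<rho>) (den A ?\<rho>')" and v: "valid_ctx \<Gamma>"
    using Cons.prems by simp_all
  show ?case using Cons.IH[OF v e] large.eeq_conv[OF A large.eeq_sym[OF x]] by simp
qed simp

lemma env_eq_trans:
  "valid_ctx \<Gamma> \<Longrightarrow> env_eq \<Gamma> w \<rho>1 \<rho>2 \<Longrightarrow> env_eq \<Gamma> w \<rho>2 \<rho>3 \<Longrightarrow> env_eq \<Gamma> w \<rho>1 \<rho>3"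
proof (induction \<Gamma> arbitrary: \<rho>1 \<rho>2 \<rho>3)
  case (Cons A \<Gamma>)
  let ?s = "\<lambda>\<rho> :: nat \<Rightarrow> dom. \<lambda>i. \<rho> (Suc i)"
  have 12: "env_eq \<Gamma> w (?s \<rho>1) (?s \<rho>2)" and 23: "env_eq \<Gamma> w (?s \<rho>2) (?s \<rho>3)"
    and x: "eeq w (den A (?s \<rho>1)) (\<rho>1 0) (\<rho>2 0)" and y: "eeq w (den A (?s \<rho>2)) (\<rho>2 0) (\<rho>3 0)"
    and v: "valid_ctx \<Gamma>"
    using Cons.prems by simp_all
  have "teq w (den A (?s \<rho>2)) (den A (?s \<rho>1))"
    using Cons.prems(1) env_eq_sym[OF v 12] by simp
  then have "eeq w (den A (?s \<rho>1)) (\<rho>1 0) (\<rho>3 0)"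
    using large.eeq_trans[OF x] large.eeq_conv y by blast
  then show ?case using Cons.IH[OF v 12 23] by simp
qed simp

lemma env_eq_refl: "valid_ctx \<Gamma> \<Longrightarrow> env_eq \<Gamma> w \<rho> \<rho>' \<Longrightarrow> env_eq \<Gamma> w \<rho> \<rho>"
  using env_eq_trans env_eq_sym by blast

lemma sem_type_valid: "sem_type \<Gamma> A B \<Longrightarrow> valid_ctx \<Gamma>"
  by (simp add: sem_type_def)

lemma sem_typeD: "sem_type \<Gamma> A B \<Longrightarrow> env_eq \<Gamma> w \<rho> \<rho>' \<Longrightarrow> teq w (den A \<rho>) (den B \<rho>')"
  by (simp add: sem_type_def)

lemma sem_term_type: "sem_term \<Gamma> t u A \<Longrightarrow> sem_type \<Gamma> A A"
  by (simp add: sem_term_def)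

lemma sem_term_valid: "sem_term \<Gamma> t u A \<Longrightarrow> valid_ctx \<Gamma>"
  by (simp add: sem_term_def sem_type_def)

lemma sem_termD: "sem_term \<Gamma> t u A \<Longrightarrow> env_eq \<Gamma> w \<rho> \<rho>' \<Longrightarrow> eeq w (den A \<rho>) (den t \<rho>) (den u \<rho>')"
  by (simp add: sem_term_def)

lemma sem_type_consD:
  "sem_type (A # \<Gamma>) B B' \<Longrightarrow> env_eq \<Gamma> w \<rho> \<rho>' \<Longrightarrow> eeq w (den A \<rho>) x y \<Longrightarrow>
    teq w (den B (case_nat x \<rho>)) (den B' (case_nat y \<rho>'))"
  by (rule sem_typeD) auto

lemma sem_term_consD:
  "sem_term (A # \<Gamma>) t u B \<Longrightarrow> env_eq \<Gamma> w \<rho> \<rho>' \<Longrightarrow> eeq w (den A \<rho>) x y \<Longrightarrow>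
    eeq w (den B (case_nat x \<rho>)) (den t (case_nat x \<rho>)) (den u (case_nat y \<rho>'))"
  by (rule sem_termD) auto

lemma valid_ctx_head: "valid_ctx (A # \<Gamma>) \<Longrightarrow> sem_type \<Gamma> A A"
  by (simp add: sem_type_def)

lemma sem_type_ctx: "sem_type \<Gamma> A A \<Longrightarrow> valid_ctx (A # \<Gamma>)"
  by (simp add: sem_type_def)

lemma sem_type_sym: "sem_type \<Gamma> A B \<Longrightarrow> sem_type \<Gamma> B A"
  unfolding sem_type_def using env_eq_sym large.teq_sym by blast

lemma sem_type_trans:
  assumes "sem_type \<Gamma> A B" "sem_type \<Gamma> B C"
  shows "sem_type \<Gamma> A C"
  unfolding sem_type_def
proof (intro conjI allI impI)
  show v: "valid_ctx \<Gamma>" using assms(1) by (rule sem_type_valid)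
  fix w \<rho> \<rho>' assume e: "env_eq \<Gamma> w \<rho> \<rho>'"
  show "teq w (den A \<rho>) (den C \<rho>')"
    by (rule large.teq_trans[OF sem_typeD[OF assms(1) env_eq_refl[OF v e]] sem_typeD[OF assms(2) e]])
qed

lemma sem_type_refl: "sem_type \<Gamma> A B \<Longrightarrow> sem_type \<Gamma> A A"
  using sem_type_trans sem_type_sym by blast

lemma sem_term_sym:
  assumes "sem_term \<Gamma> t u A"
  shows "sem_term \<Gamma> u t A"
  unfolding sem_term_def
proof (intro conjI allI impI)
  show ty: "sem_type \<Gamma> A A" using assms by (rule sem_term_type)
  fix w \<rho> \<rho>' assume "env_eq \<Gamma> w \<rho> \<rho>'"
  then have e: "env_eq \<Gamma> w \<rho>' \<rho>" by (rule env_eq_sym[OF sem_type_valid[OF ty]])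
  show "eeq w (den A \<rho>) (den u \<rho>) (den t \<rho>')"
    by (rule large.eeq_conv[OF sem_typeD[OF ty e] large.eeq_sym[OF sem_termD[OF assms e]]])
qed

lemma sem_term_trans:
  assumes "sem_term \<Gamma> t u A" "sem_term \<Gamma> u v A"
  shows "sem_term \<Gamma> t v A"
  unfolding sem_term_def
proof (intro conjI allI impI)
  show "sem_type \<Gamma> A A" using assms(1) by (rule sem_term_type)
  fix w \<rho> \<rho>' assume e: "env_eq \<Gamma> w \<rho> \<rho>'"
  have "env_eq \<Gamma> w \<rho> \<rho>" by (rule env_eq_refl[OF sem_term_valid[OF assms(1)] e])
  then show "eeq w (den A \<rho>) (den t \<rho>) (den v \<rho>')"
    using large.eeq_trans sem_termD assms e by blast
qed

lemma sem_term_refl: "sem_term \<Gamma> t u A \<Longrightarrow> sem_term \<Gamma> t t A"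
  using sem_term_trans sem_term_sym by blast

lemma sem_term_conv:
  assumes "sem_term \<Gamma> t u A" "sem_type \<Gamma> A B"
  shows "sem_term \<Gamma> t u B"
  unfolding sem_term_def
proof (intro conjI allI impI)
  show "sem_type \<Gamma> B B" using assms(2) sem_type_refl sem_type_sym by blast
  fix w \<rho> \<rho>' assume e: "env_eq \<Gamma> w \<rho> \<rho>'"
  have "env_eq \<Gamma> w \<rho> \<rho>" by (rule env_eq_refl[OF sem_term_valid[OF assms(1)] e])
  then show "eeq w (den B \<rho>) (den t \<rho>) (den u \<rho>')"
    using large.eeq_conv[OF sem_typeD[OF assms(2)]] sem_termD[OF assms(1) e] by blast
qed

text \<open>Computation rules hold as identities of denotations, so it is enough to type one side
  semantically.\<close>

lemma sem_term_den_eq: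
  assumes "sem_term \<Gamma> u u A" "\<And>w \<rho> \<rho>'. env_eq \<Gamma> w \<rho> \<rho>' \<Longrightarrow> den t \<rho> = den u \<rho>"
  shows "sem_term \<Gamma> t u A"
  using assms unfolding sem_term_def by metis

section \<open>Variables, functions and pairs\<close>

lemma sem_var_aux:
  assumes "valid_ctx \<Gamma>" "i < length \<Gamma>" "env_eq \<Gamma> w \<rho> \<rho>'"
  shows "teq w (den (\<Gamma> ! i) (\<lambda>j. \<rho> (j + Suc i))) (den (\<Gamma> ! i) (\<lambda>j. \<rho>' (j + Suc i))) \<and>
    eeq w (den (\<Gamma> ! i) (\<lambda>j. \<rho> (j + Suc i))) (\<rho> i) (\<rho>' i)"
  using assms
proof (induction \<Gamma> arbitrary: i \<rho> \<rho>')
  case (Cons A \<Gamma>)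
  show ?case
  proof (cases i)
    case 0
    then show ?thesis using Cons.prems by simp
  next
    case (Suc k)
    then show ?thesis
      using Cons.IH[of k "\<lambda>i. \<rho> (Suc i)" "\<lambda>i. \<rho>' (Suc i)"] Cons.prems by simp
  qed
qed simp

lemma sem_var:
  "valid_ctx \<Gamma> \<Longrightarrow> i < length \<Gamma> \<Longrightarrow> sem_term \<Gamma> (Var i) (Var i) (ren (\<lambda>j. j + Suc i) (\<Gamma> ! i))"
  using sem_var_aux unfolding sem_term_def sem_type_def by simp

lemma sem_pi:
  assumes A: "sem_type \<Gamma> A A'" and B: "sem_type (A # \<Gamma>) B B'"
  shows "sem_type \<Gamma> (PiT A B) (PiT A' B')"
  unfolding sem_type_def
proof (intro conjI allI impI)
  show "valid_ctx \<Gamma>" using A by (rule sem_type_valid)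
  fix w \<rho> \<rho>' assume e: "env_eq \<Gamma> w \<rho> \<rho>'"
  show "teq w (den (PiT A B) \<rho>) (den (PiT A' B') \<rho>')"
    \<comment> \<open>The codomain is required at all worlds below \<open>w\<close>, hence the
      environment is first moved there.\<close>
    using sem_typeD[OF A e] sem_type_consD[OF B env_eq_antimono[OF e]]
    by (simp only: den.simps large.teq_pi_iff app_den_lam) blast
qed

lemma sem_sig:
  assumes A: "sem_type \<Gamma> A A'" and B: "sem_type (A # \<Gamma>) B B'"
  shows "sem_type \<Gamma> (SigT A B) (SigT A' B')"
  unfolding sem_type_def
proof (intro conjI allI impI)
  show "valid_ctx \<Gamma>" using A by (rule sem_type_valid)
  fix w \<rho> \<rho>' assume e: "env_eq \<Gamma> w \<rho> \<rho>'"
  show "teq w (den (SigT A B) \<rho>) (den (SigT A' B') \<rho>')"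
    using sem_typeD[OF A e] sem_type_consD[OF B env_eq_antimono[OF e]]
    by (simp only: den.simps large.teq_sig_iff app_den_lam) blast
qed

lemma sem_term_piD:
  assumes "sem_term \<Gamma> h h' (PiT A B)" and e: "env_eq \<Gamma> w \<rho> \<rho>'" and x: "eeq w (den A \<rho>) x y"
  shows "eeq w (den B (case_nat x \<rho>)) (app (den h \<rho>) x) (app (den h' \<rho>') y)"
  using sem_termD[OF assms(1) e] sem_typeD[OF sem_term_type[OF assms(1)] e] x
  by (simp only: den.simps large.eeq_pi_iff app_den_lam)

text \<open>A premise for all worlds absorbs the Kripke quantifier of \<open>pi_per\<close>, again
  because environments persist to lower worlds.\<close>

lemma sem_term_piI:
  assumes B: "sem_type (A # \<Gamma>) B B"
    and "\<And>w \<rho> \<rho>' x y. env_eq \<Gamma> w \<rho> \<rho>' \<Longrightarrow> eeq w (den A \<rho>) x y \<Longrightarrow>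
      eeq w (den B (case_nat x \<rho>)) (app (den h \<rho>) x) (app (den h' \<rho>') y)"
  shows "sem_term \<Gamma> h h' (PiT A B)"
  unfolding sem_term_def
proof (intro conjI allI impI)
  show ty: "sem_type \<Gamma> (PiT A B) (PiT A B)"
    using sem_pi[OF valid_ctx_head[OF sem_type_valid[OF B]] B] .
  fix w \<rho> \<rho>' assume e: "env_eq \<Gamma> w \<rho> \<rho>'"
  show "eeq w (den (PiT A B) \<rho>) (den h \<rho>) (den h' \<rho>')"
    using sem_typeD[OF ty e] assms(2)[OF env_eq_antimono[OF e]]
    by (simp only: den.simps large.eeq_pi_iff app_den_lam) blast
qed

lemma sem_lam: "sem_term (A # \<Gamma>) t t' B \<Longrightarrow> sem_term \<Gamma> (Lam t) (Lam t') (PiT A B)"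
  by (rule sem_term_piI) (simp_all add: sem_term_type sem_term_consD)

lemma sem_type_pi_inst:
  assumes "sem_type \<Gamma> (PiT A B) (PiT A B)" "sem_term \<Gamma> a a A"
  shows "sem_type \<Gamma> (B\<lbrakk>a\<rbrakk>) (B\<lbrakk>a\<rbrakk>)"
  unfolding sem_type_def
proof (intro conjI allI impI)
  show "valid_ctx \<Gamma>" using assms(1) by (rule sem_type_valid)
  fix w \<rho> \<rho>' assume e: "env_eq \<Gamma> w \<rho> \<rho>'"
  show "teq w (den (B\<lbrakk>a\<rbrakk>) \<rho>) (den (B\<lbrakk>a\<rbrakk>) \<rho>')"
    using sem_typeD[OF assms(1) e] sem_termD[OF assms(2) e]
    by (simp only: den.simps large.teq_pi_iff app_den_lam den_inst)
qed

lemma sem_inst: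
  assumes "sem_term (A # \<Gamma>) t t B" "sem_term \<Gamma> a a A"
  shows "sem_term \<Gamma> (t\<lbrakk>a\<rbrakk>) (t\<lbrakk>a\<rbrakk>) (B\<lbrakk>a\<rbrakk>)"
  unfolding sem_term_def
proof (intro conjI allI impI)
  show "sem_type \<Gamma> (B\<lbrakk>a\<rbrakk>) (B\<lbrakk>a\<rbrakk>)"
    using sem_type_pi_inst[OF sem_term_type[OF sem_lam[OF assms(1)]] assms(2)] .
  fix w \<rho> \<rho>' assume e: "env_eq \<Gamma> w \<rho> \<rho>'"
  show "eeq w (den (B\<lbrakk>a\<rbrakk>) \<rho>) (den (t\<lbrakk>a\<rbrakk>) \<rho>) (den (t\<lbrakk>a\<rbrakk>) \<rho>')"
    using sem_term_consD[OF assms(1) e sem_termD[OF assms(2) e]] by simp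
qed

lemma sem_app:
  assumes h: "sem_term \<Gamma> h h' (PiT A B)" and a: "sem_term \<Gamma> a a' A"
  shows "sem_term \<Gamma> (App h a) (App h' a') (B\<lbrakk>a\<rbrakk>)"
  unfolding sem_term_def
proof (intro conjI allI impI)
  show "sem_type \<Gamma> (B\<lbrakk>a\<rbrakk>) (B\<lbrakk>a\<rbrakk>)"
    using sem_type_pi_inst[OF sem_term_type[OF h] sem_term_refl[OF a]] .
  fix w \<rho> \<rho>' assume e: "env_eq \<Gamma> w \<rho> \<rho>'"
  show "eeq w (den (B\<lbrakk>a\<rbrakk>) \<rho>) (den (App h a) \<rho>) (den (App h' a') \<rho>')"
    using sem_term_piD[OF h e sem_termD[OF a e]] by simp
qed

lemma sem_beta:
  assumes "sem_term (A # \<Gamma>) t t B" "sem_term \<Gamma> a a A"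
  shows "sem_term \<Gamma> (App (Lam t) a) (t\<lbrakk>a\<rbrakk>) (B\<lbrakk>a\<rbrakk>)"
  by (rule sem_term_den_eq[OF sem_inst[OF assms]]) simp

lemma sem_pi_ext:
  assumes h: "sem_term \<Gamma> h h (PiT A B)"
    and hg: "sem_term (A # \<Gamma>) (App (wk h) (Var 0)) (App (wk g) (Var 0)) B"
  shows "sem_term \<Gamma> h g (PiT A B)"
  by (rule sem_term_piI[OF sem_term_type[OF hg]]) (use sem_term_consD[OF hg] in simp)

lemma sem_sig_fam_inst:
  assumes "sem_type \<Gamma> (SigT A B) (SigT A B)" "sem_term \<Gamma> a a A"
  shows "sem_type \<Gamma> (B\<lbrakk>a\<rbrakk>) (B\<lbrakk>a\<rbrakk>)"
  unfolding sem_type_def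
proof (intro conjI allI impI)
  show "valid_ctx \<Gamma>" using assms(1) by (rule sem_type_valid)
  fix w \<rho> \<rho>' assume e: "env_eq \<Gamma> w \<rho> \<rho>'"
  show "teq w (den (B\<lbrakk>a\<rbrakk>) \<rho>) (den (B\<lbrakk>a\<rbrakk>) \<rho>')"
    using sem_typeD[OF assms(1) e] sem_termD[OF assms(2) e]
    by (simp only: den.simps large.teq_sig_iff app_den_lam den_inst)
qed

lemma sem_term_sigI:
  assumes ty: "sem_type \<Gamma> (SigT A B) (SigT A B)"
    and p1: "sem_term \<Gamma> (Proj1 t) (Proj1 u) A" and p2: "sem_term \<Gamma> (Proj2 t) (Proj2 u) (B\<lbrakk>Proj1 t\<rbrakk>)"
  shows "sem_term \<Gamma> t u (SigT A B)"
  unfolding sem_term_def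
proof (intro conjI allI impI ty)
  fix w \<rho> \<rho>' assume e: "env_eq \<Gamma> w \<rho> \<rho>'"
  show "eeq w (den (SigT A B) \<rho>) (den t \<rho>) (den u \<rho>')"
    using sem_typeD[OF ty e] sem_termD[OF p1 e] sem_termD[OF p2 e]
    by (simp only: den.simps large.eeq_sig_iff app_den_lam den_inst)
qed

lemma sem_pair:
  assumes B: "sem_type (A # \<Gamma>) B B" and a: "sem_term \<Gamma> a a' A" and b: "sem_term \<Gamma> b b' (B\<lbrakk>a\<rbrakk>)"
  shows "sem_term \<Gamma> (MkPair a b) (MkPair a' b') (SigT A B)"
  unfolding sem_term_def
proof (intro conjI allI impI)
  show ty: "sem_type \<Gamma> (SigT A B) (SigT A B)"
    using sem_sig[OF valid_ctx_head[OF sem_type_valid[OF B]] B] .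
  fix w \<rho> \<rho>' assume e: "env_eq \<Gamma> w \<rho> \<rho>'"
  show "eeq w (den (SigT A B) \<rho>) (den (MkPair a b) \<rho>) (den (MkPair a' b') \<rho>')"
    using sem_typeD[OF ty e] sem_termD[OF a e] sem_termD[OF b e]
    by (simp only: den.simps large.eeq_sig_iff app_den_lam den_inst proj1_pair proj2_pair)
qed

lemma sem_fst:
  assumes "sem_term \<Gamma> t t' (SigT A B)"
  shows "sem_term \<Gamma> (Proj1 t) (Proj1 t') A"
  unfolding sem_term_def sem_type_def
proof (intro conjI allI impI)
  note ty = sem_term_type[OF assms]
  show "valid_ctx \<Gamma>" using assms by (rule sem_term_valid)
  fix w \<rho> \<rho>' assume e: "env_eq \<Gamma> w \<rho> \<rho>'"
  show "teq w (den A \<rho>) (den A \<rho>')"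
    using sem_typeD[OF ty e] by (simp only: den.simps large.teq_sig_iff)
  show "eeq w (den A \<rho>) (den (Proj1 t) \<rho>) (den (Proj1 t') \<rho>')"
    using sem_typeD[OF ty e] sem_termD[OF assms e] by (simp only: den.simps large.eeq_sig_iff)
qed

lemma sem_snd:
  assumes "sem_term \<Gamma> t t' (SigT A B)"
  shows "sem_term \<Gamma> (Proj2 t) (Proj2 t') (B\<lbrakk>Proj1 t\<rbrakk>)"
  unfolding sem_term_def
proof (intro conjI allI impI)
  note ty = sem_term_type[OF assms]
  show "sem_type \<Gamma> (B\<lbrakk>Proj1 t\<rbrakk>) (B\<lbrakk>Proj1 t\<rbrakk>)"
    using sem_sig_fam_inst[OF ty sem_term_refl[OF sem_fst[OF assms]]] .
  fix w \<rho> \<rho>' assume e: "env_eq \<Gamma> w \<rho> \<rho>'"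
  show "eeq w (den (B\<lbrakk>Proj1 t\<rbrakk>) \<rho>) (den (Proj2 t) \<rho>) (den (Proj2 t') \<rho>')"
    using sem_typeD[OF ty e] sem_termD[OF assms e]
    by (simp only: den.simps large.eeq_sig_iff app_den_lam den_inst)
qed

section \<open>Base types and their recursors\<close>

lemma sem_atom: "valid_ctx \<Gamma> \<Longrightarrow> (\<And>\<rho>. den A \<rho> = {Atm c}) \<Longrightarrow> sem_type \<Gamma> A A"
  by (simp add: sem_type_def)

lemma sem_tok:
  "valid_ctx \<Gamma> \<Longrightarrow> (\<And>\<rho>. den A \<rho> = {Atm c}) \<Longrightarrow> (\<And>\<rho>. den t \<rho> = {s}) \<Longrightarrow>
    (\<And>w. atom_tok w c s) \<Longrightarrow> sem_term \<Gamma> t t A"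
  by (simp add: sem_term_def sem_atom large.eeq_atom_iff)

lemma sem_succ: "sem_term \<Gamma> n n' NN \<Longrightarrow> sem_term \<Gamma> (TSucc n) (TSucc n') NN"
  unfolding sem_term_def by (force simp: large.eeq_atom_iff intro: atom_tok.intros)

text \<open>\<open>elim\<close> computes token by token, so the successor equation is checked on a
  number that is a single token.\<close>

lemma sem_nat_token:
  "sem_term \<Gamma> n n NN \<Longrightarrow> env_eq \<Gamma> w \<rho> \<rho>' \<Longrightarrow> \<exists>s. den n \<rho> = {s}"
  by (drule (1) sem_termD) (auto simp: large.eeq_atom_iff)

lemma atom_tok_raise_world: "atom_tok w c Err \<Longrightarrow> \<not> w"
  by (erule atom_tok.cases) auto

text \<open>What the four eliminators share. If the scrutinee is \<open>Err\<close>, so is the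
  result, and the world is \<open>False\<close>; the motive at \<open>{Err}\<close> is a type there
  and hence contains the exception.\<close>

lemma sem_atom_elim:
  assumes F: "sem_type (C # \<Gamma>) F F" and C: "\<And>\<rho>. den C \<rho> = {Atm c}"
    and tok: "\<And>w \<rho> \<rho>' s. env_eq \<Gamma> w \<rho> \<rho>' \<Longrightarrow> atom_tok w c s \<Longrightarrow> s \<noteq> Err \<Longrightarrow>
      eeq w (den F (case_nat {s} \<rho>)) (app (den R \<rho>) {s}) (app (den R' \<rho>') {s})"
    and raise: "\<And>\<rho>. app (den R \<rho>) {Err} = {Err}" "\<And>\<rho>. app (den R' \<rho>) {Err} = {Err}"
  shows "sem_term \<Gamma> R R' (PiT C F)"
proof (rule sem_term_piI[OF F])
  fix w \<rho> \<rho>' x y assume e: "env_eq \<Gamma> w \<rho> \<rho>'" and "eeq w (den C \<rho>) x y"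
  then obtain s where s: "atom_tok w c s" and xy: "x = {s}" "y = {s}"
    by (auto simp: C large.eeq_atom_iff)
  show "eeq w (den F (case_nat x \<rho>)) (app (den R \<rho>) x) (app (den R' \<rho>') y)"
  proof (cases "s = Err")
    case True
    then have w: "w = False" using s atom_tok_raise_world by blast
    have "env_eq \<Gamma> w \<rho> \<rho>"
      using env_eq_refl e sem_type_valid[OF valid_ctx_head[OF sem_type_valid[OF F]]] by blast
    then have "teq w (den F (case_nat {Err} \<rho>)) (den F (case_nat {Err} \<rho>))"
      by (rule sem_type_consD[OF F]) (use s True C large.eeq_atom_iff in auto)
    then show ?thesis using large.eeq_raise raise True xy w by simp
  qed (use tok[OF e s] xy in simp)
qed

text \<open>\<open>N0\<close> has no token other than \<open>Err\<close>, so the case of proper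
  tokens is vacuous.\<close>

lemma sem_rec0: "sem_type (N0 # \<Gamma>) F F \<Longrightarrow> sem_term \<Gamma> (RecN0 F) (RecN0 F') (PiT N0 F)"
  by (erule sem_atom_elim) (auto elim: atom_tok.cases)

lemma sem_rec1:
  assumes F: "sem_type (N1 # \<Gamma>) F F" and a: "sem_term \<Gamma> a a' (F\<lbrakk>TZero\<rbrakk>)"
  shows "sem_term \<Gamma> (RecN1 F a) (RecN1 F' a') (PiT N1 F)"
proof (rule sem_atom_elim[OF F])
  fix w \<rho> \<rho>' s assume e: "env_eq \<Gamma> w \<rho> \<rho>'" and "atom_tok w AtN1 s" "s \<noteq> Err"
  then have "s = Zer" by (auto elim: atom_tok.cases)
  then show "eeq w (den F (case_nat {s} \<rho>)) (app (den (RecN1 F a) \<rho>) {s}) (app (den (RecN1 F' a') \<rho>') {s})"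
    using sem_termD[OF a e] by simp
qed auto

lemma sem_rec2:
  assumes F: "sem_type (N2 # \<Gamma>) F F"
    and a: "sem_term \<Gamma> a a' (F\<lbrakk>TZero\<rbrakk>)" and b: "sem_term \<Gamma> b b' (F\<lbrakk>TOne\<rbrakk>)"
  shows "sem_term \<Gamma> (RecN2 F a b) (RecN2 F' a' b') (PiT N2 F)"
proof (rule sem_atom_elim[OF F])
  fix w \<rho> \<rho>' s assume e: "env_eq \<Gamma> w \<rho> \<rho>'" and "atom_tok w AtN2 s" "s \<noteq> Err"
  then consider "s = Zer" | "s = One" by (auto elim: atom_tok.cases)
  then show "eeq w (den F (case_nat {s} \<rho>)) (app (den (RecN2 F a b) \<rho>) {s}) (app (den (RecN2 F' a' b') \<rho>') {s})"
    using sem_termD[OF a e] sem_termD[OF b e] by cases simp_all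
qed auto

lemma sem_step:
  assumes g: "sem_term \<Gamma> g g' (step_ty F)" and e: "env_eq \<Gamma> w \<rho> \<rho>'"
    and s: "atom_tok w AtN s" and xy: "eeq w (den F (case_nat {s} \<rho>)) x y"
  shows "eeq w (den F (case_nat {Su s} \<rho>)) (app (app (den g \<rho>) {s}) x) (app (app (den g' \<rho>') {s}) y)"
proof -
  let ?P = "pi_code (den F (case_nat {s} \<rho>)) (lam (\<lambda>z. den (wk (inst_succ F)) (case_nat z (case_nat {s} \<rho>))))"
  have v: "env_eq \<Gamma> w \<rho> \<rho>" using env_eq_refl[OF sem_term_valid[OF g] e] .
  have ss: "eeq w (den NN \<rho>) {s} {s}" using s by (simp add: large.eeq_atom_iff)
  have 1: "eeq w ?P (app (den g \<rho>) {s}) (app (den g' \<rho>') {s})"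
    using sem_term_piD[OF g[unfolded step_ty_def] e ss] unfolding Arr_def den.simps .
  show ?thesis
    using 1 large.eeq_pi_iff[OF large.eeq_type[OF 1], of "app (den g \<rho>) {s}" "app (den g' \<rho>') {s}"] xy
    by (simp only: app_den_lam) (auto dest!: spec[of _ w])
qed

lemma sem_rec:
  assumes F: "sem_type (NN # \<Gamma>) F F"
    and a: "sem_term \<Gamma> a a' (F\<lbrakk>TZero\<rbrakk>)" and g: "sem_term \<Gamma> g g' (step_ty F)"
  shows "sem_term \<Gamma> (RecN F a g) (RecN F' a' g') (PiT NN F)"
proof (rule sem_atom_elim[OF F])
  fix w \<rho> \<rho>' s assume e: "env_eq \<Gamma> w \<rho> \<rho>'" and s: "atom_tok w AtN s"
  from s have "eeq w (den F (case_nat {s} \<rho>))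
      (tok_rec (den a \<rho>) {} (den g \<rho>) s) (tok_rec (den a' \<rho>') {} (den g' \<rho>') s)"
    using e
  proof (induction w "AtN" s rule: atom_tok.induct)
    case (4 w)
    then show ?case using sem_termD[OF a] by simp
  next
    case (5 w s)
    then show ?case using sem_step[OF g] by simp
  next
    \<comment> \<open>The induction covers \<open>Err\<close> too, as it is the base of exceptional
      numbers such as \<open>Su Err\<close>.\<close>
    case 6
    have "env_eq \<Gamma> False \<rho> \<rho>" using env_eq_refl[OF sem_term_valid[OF a] 6] .
    then have "teq False (den F (case_nat {Err} \<rho>)) (den F (case_nat {Err} \<rho>))"
      by (rule sem_type_consD[OF F]) (auto simp: large.eeq_atom_iff intro: atom_tok.intros)
    then show ?case using large.eeq_raise by simp
  qed
  then show "eeq w (den F (case_nat {s} \<rho>)) (app (den (RecN F a g) \<rho>) {s}) (app (den (RecN F' a' g') \<rho>') {s})"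
    by simp
qed auto

lemma sem_rec_succ:
  assumes F: "sem_type (NN # \<Gamma>) F F"
    and a: "sem_term \<Gamma> a a (F\<lbrakk>TZero\<rbrakk>)" and g: "sem_term \<Gamma> g g (step_ty F)" and n: "sem_term \<Gamma> n n NN"
  shows "sem_term \<Gamma> (App (RecN F a g) (TSucc n)) (App (App g n) (App (RecN F a g) n)) (F\<lbrakk>TSucc n\<rbrakk>)"
\<comment> \<open>The left side is the one whose typing at \<open>F[S n]\<close> is immediate, so
  the equation is proved backwards.\<close>
proof (rule sem_term_sym[OF sem_term_den_eq])
  show "sem_term \<Gamma> (App (RecN F a g) (TSucc n)) (App (RecN F a g) (TSucc n)) (F\<lbrakk>TSucc n\<rbrakk>)"
    by (rule sem_app[OF sem_rec[OF F a g] sem_succ[OF n]])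
  fix w \<rho> \<rho>' assume "env_eq \<Gamma> w \<rho> \<rho>'"
  from sem_nat_token[OF n this]
  show "den (App (App g n) (App (RecN F a g) n)) \<rho> = den (App (RecN F a g) (TSucc n)) \<rho>"
    by auto
qed

section \<open>The universe\<close>

lemma sem_univ: "valid_ctx \<Gamma> \<Longrightarrow> sem_type \<Gamma> UU UU"
  by (simp add: sem_type_def)

lemma sem_term_univ_iff:
  "sem_term \<Gamma> A B UU \<longleftrightarrow> valid_ctx \<Gamma> \<and>
    (\<forall>w \<rho> \<rho>'. env_eq \<Gamma> w \<rho> \<rho>' \<longrightarrow> type_eq None w (den A \<rho>) (den B \<rho>'))"
  by (auto simp: sem_term_def sem_univ sem_type_valid eeq_univ_iff)

lemma sem_el: "sem_term \<Gamma> A B UU \<Longrightarrow> sem_type \<Gamma> A B"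
  by (simp add: sem_term_univ_iff sem_type_def teq_lift)

lemma sem_univ_atom: "valid_ctx \<Gamma> \<Longrightarrow> (\<And>\<rho>. den A \<rho> = {Atm c}) \<Longrightarrow> sem_term \<Gamma> A A UU"
  by (simp add: sem_term_univ_iff)

text \<open>Small elements of the domain are lifted to the large level, of which the hypothesis on
  \<open>B\<close> speaks.\<close>

lemma sem_univ_consD:
  "sem_term (A # \<Gamma>) B B' UU \<Longrightarrow> env_eq \<Gamma> w \<rho> \<rho>' \<Longrightarrow> elem_eq None w (den A \<rho>) x y \<Longrightarrow>
    type_eq None w (den B (case_nat x \<rho>)) (den B' (case_nat y \<rho>'))"
  using sem_term_consD eeq_lift by (fastforce simp: eeq_univ_iff)

lemma sem_univ_pi:
  assumes A: "sem_term \<Gamma> A A' UU" and B: "sem_term (A # \<Gamma>) B B' UU"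
  shows "sem_term \<Gamma> (PiT A B) (PiT A' B') UU"
  unfolding sem_term_univ_iff
proof (intro conjI allI impI)
  show "valid_ctx \<Gamma>" using A by (rule sem_term_valid)
  fix w \<rho> \<rho>' assume e: "env_eq \<Gamma> w \<rho> \<rho>'"
  show "type_eq None w (den (PiT A B) \<rho>) (den (PiT A' B') \<rho>')"
    using A e sem_univ_consD[OF B env_eq_antimono[OF e]]
    by (simp only: den.simps small.teq_pi_iff app_den_lam sem_term_univ_iff) blast
qed

lemma sem_univ_sig:
  assumes A: "sem_term \<Gamma> A A' UU" and B: "sem_term (A # \<Gamma>) B B' UU"
  shows "sem_term \<Gamma> (SigT A B) (SigT A' B') UU"
  unfolding sem_term_univ_iff
proof (intro conjI allI impI)
  show "valid_ctx \<Gamma>" using A by (rule sem_term_valid)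
  fix w \<rho> \<rho>' assume e: "env_eq \<Gamma> w \<rho> \<rho>'"
  show "type_eq None w (den (SigT A B) \<rho>) (den (SigT A' B') \<rho>')"
    using A e sem_univ_consD[OF B env_eq_antimono[OF e]]
    by (simp only: den.simps small.teq_sig_iff app_den_lam sem_term_univ_iff) blast
qed

text \<open>Well-formedness is read as the diagonal of equality, so a formation, introduction or
  elimination rule and its congruence rule follow from one semantic lemma.\<close>

theorem soundness:
  "\<turnstile> \<Gamma> \<Longrightarrow> valid_ctx \<Gamma>"
  "\<Gamma> \<turnstile> A \<Longrightarrow> sem_type \<Gamma> A A"
  "\<Gamma> \<turnstile> A \<simeq> B \<Longrightarrow> sem_type \<Gamma> A B"
  "\<Gamma> \<turnstile> t \<Ztypecolon> A \<Longrightarrow> sem_term \<Gamma> t t A"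
  "\<Gamma> \<turnstile> t \<simeq> u \<Ztypecolon> A \<Longrightarrow> sem_term \<Gamma> t u A"
proof (induction rule: wf_ctx_is_type_eq_type_has_type_eq_term.inducts)
  case ctx_empty show ?case by simp
next
  case ctx_ext from ctx_ext.IH show ?case by (rule sem_type_ctx)
next
  case var from var.IH var.hyps(2) show ?case by (rule sem_var)
next
  case type_refl from type_refl.IH show ?case .
next
  case type_sym from type_sym.IH show ?case by (rule sem_type_sym)
next
  case type_trans from type_trans.IH show ?case by (rule sem_type_trans)
next
  case term_refl from term_refl.IH show ?case .
next
  case term_sym from term_sym.IH show ?case by (rule sem_term_sym)
next
  case term_trans from term_trans.IH show ?case by (rule sem_term_trans)
next
  case conv from conv.IH show ?case by (rule sem_term_conv)
next
  case conv_eq from conv_eq.IH show ?case by (rule sem_term_conv)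
next
  case N0_form from N0_form.IH show ?case by (rule sem_atom) simp
next
  case N0_elim from N0_elim.IH show ?case by (rule sem_rec0)
next
  case N0_elim_cong from N0_elim_cong.IH show ?case by (rule sem_rec0[OF sem_type_refl])
next
  case N1_form from N1_form.IH show ?case by (rule sem_atom) simp
next
  case N1_zero from N1_zero.IH show ?case by (rule sem_tok) (auto intro: atom_tok.intros)
next
  case N1_elim from N1_elim.IH show ?case by (rule sem_rec1)
next
  case N1_elim_cong from N1_elim_cong.IH show ?case by (rule sem_rec1[OF sem_type_refl])
next
  case N1_comp show ?case by (rule sem_term_den_eq[OF N1_comp.IH(2)]) simp
next
  case N2_form from N2_form.IH show ?case by (rule sem_atom) simp
next
  case N2_zero from N2_zero.IH show ?case by (rule sem_tok) (auto intro: atom_tok.intros)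
next
  case N2_one from N2_one.IH show ?case by (rule sem_tok) (auto intro: atom_tok.intros)
next
  case N2_elim from N2_elim.IH show ?case by (rule sem_rec2)
next
  case N2_elim_cong from N2_elim_cong.IH show ?case by (rule sem_rec2[OF sem_type_refl])
next
  case (N2_comp_zero \<Gamma> F a b) show ?case by (rule sem_term_den_eq[OF N2_comp_zero.IH(2)]) simp
next
  case (N2_comp_one \<Gamma> F a b) show ?case by (rule sem_term_den_eq[OF N2_comp_one.IH(3)]) simp
next
  case N_form from N_form.IH show ?case by (rule sem_atom) simp
next
  case N_zero from N_zero.IH show ?case by (rule sem_tok) (auto intro: atom_tok.intros)
next
  case N_succ from N_succ.IH show ?case by (rule sem_succ)
next
  case N_succ_cong from N_succ_cong.IH show ?case by (rule sem_succ)
next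
  case N_elim from N_elim.IH show ?case by (rule sem_rec)
next
  case N_elim_cong from N_elim_cong.IH show ?case by (rule sem_rec[OF sem_type_refl])
next
  case (N_comp_zero \<Gamma> F a g) show ?case by (rule sem_term_den_eq[OF N_comp_zero.IH(2)]) simp
next
  case N_comp_succ from N_comp_succ.IH show ?case by (rule sem_rec_succ)
next
  case Pi_form from Pi_form.IH show ?case by (rule sem_pi)
next
  case Pi_cong from Pi_cong.IH show ?case by (rule sem_pi)
next
  case Pi_intro from Pi_intro.IH show ?case by (rule sem_lam)
next
  case Pi_intro_cong from Pi_intro_cong.IH show ?case by (rule sem_lam)
next
  case Pi_elim from Pi_elim.IH show ?case by (rule sem_app)
next
  case Pi_elim_cong from Pi_elim_cong.IH show ?case by (rule sem_app)
next
  case Pi_beta from Pi_beta.IH show ?case by (rule sem_beta)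
next
  case Pi_ext show ?case by (rule sem_pi_ext[OF Pi_ext.IH(1,3)])
next
  case Sig_form from Sig_form.IH show ?case by (rule sem_sig)
next
  case Sig_cong from Sig_cong.IH show ?case by (rule sem_sig)
next
  case Sig_intro from Sig_intro.IH show ?case by (rule sem_pair)
next
  case Sig_intro_cong from Sig_intro_cong.IH show ?case by (rule sem_pair)
next
  case Sig_fst from Sig_fst.IH show ?case by (rule sem_fst)
next
  case Sig_fst_cong from Sig_fst_cong.IH show ?case by (rule sem_fst)
next
  case Sig_snd from Sig_snd.IH show ?case by (rule sem_snd)
next
  case Sig_snd_cong from Sig_snd_cong.IH show ?case by (rule sem_snd)
next
  case (Sig_comp_fst A \<Gamma> B a b) show ?case by (rule sem_term_den_eq[OF Sig_comp_fst.IH(2)]) simp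
next
  case (Sig_comp_snd A \<Gamma> B a b) show ?case by (rule sem_term_den_eq[OF Sig_comp_snd.IH(3)]) simp
next
  case Sig_ext show ?case by (rule sem_term_sigI[OF sem_term_type[OF Sig_ext.IH(1)] Sig_ext.IH(3,4)])
next
  case U_form from U_form.IH show ?case by (rule sem_univ)
next
  case U_type from U_type.IH show ?case by (rule sem_el)
next
  case U_type_eq from U_type_eq.IH show ?case by (rule sem_el)
next
  case U_N0 from U_N0.IH show ?case by (rule sem_univ_atom) simp
next
  case U_N1 from U_N1.IH show ?case by (rule sem_univ_atom) simp
next
  case U_N2 from U_N2.IH show ?case by (rule sem_univ_atom) simp
next
  case U_N from U_N.IH show ?case by (rule sem_univ_atom) simp
next
  case U_Pi from U_Pi.IH show ?case by (rule sem_univ_pi)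
next
  case U_Pi_cong from U_Pi_cong.IH show ?case by (rule sem_univ_pi)
next
  case U_Sig from U_Sig.IH show ?case by (rule sem_univ_sig)
next
  case U_Sig_cong from U_Sig_cong.IH show ?case by (rule sem_univ_sig)
qed

section \<open>Refuting Markov's principle\<close>

primrec lookup :: "(nat \<Rightarrow> bool) \<Rightarrow> tok \<Rightarrow> dom" where
  "lookup \<alpha> Err = {Err}"
| "lookup \<alpha> Zer = {if \<alpha> 0 then Zer else One}"
| "lookup \<alpha> One = {}"
| "lookup \<alpha> (Su s) = lookup (\<lambda>n. \<alpha> (Suc n)) s"
| "lookup \<alpha> (Fn xs s) = {}"
| "lookup \<alpha> (Fst s) = {}"
| "lookup \<alpha> (Snd s) = {}"
| "lookup \<alpha> (Atm c) = {}"
| "lookup \<alpha> Unv = {}"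
| "lookup \<alpha> PiTag = {}"
| "lookup \<alpha> SigTag = {}"

text \<open>\<open>\<alpha> n\<close> means that the sequence has the value \<open>Zer\<close> at
  \<open>n\<close>. An exceptional number such as \<open>Su Err\<close> is sent to the
  exception.\<close>

definition bits :: "(nat \<Rightarrow> bool) \<Rightarrow> dom" where
  "bits \<alpha> = lam (\<lambda>x. \<Union>s\<in>x. lookup \<alpha> s)"

primrec index :: "tok \<Rightarrow> nat" where
  "index Err = 0"
| "index Zer = 0"
| "index One = 0"
| "index (Su s) = Suc (index s)"
| "index (Fn xs s) = 0"
| "index (Fst s) = 0"
| "index (Snd s) = 0"
| "index (Atm c) = 0"
| "index Unv = 0"
| "index PiTag = 0"
| "index SigTag = 0"

lemma lookup_local: "\<alpha> (index s) = \<beta> (index s) \<Longrightarrow> lookup \<alpha> s = lookup \<beta> s"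
proof (induction s arbitrary: \<alpha> \<beta>)
  case (Su s)
  from Su.prems show ?case using Su.IH[of "\<lambda>n. \<alpha> (Suc n)" "\<lambda>n. \<beta> (Suc n)"] by simp
qed simp_all

lemma app_bits [simp]: "app (bits \<alpha>) {s} = lookup \<alpha> s"
  unfolding bits_def
  using app_lam_cont[OF cont_UN[OF cont_var[of 0] cont_const], where y = "{s}"] by simp

lemma lookup_bool:
  "atom_tok w AtN s \<Longrightarrow> \<exists>b. atom_tok w AtN2 b \<and> lookup \<alpha> s = {b}"
proof (induction w "AtN" s arbitrary: \<alpha> rule: atom_tok.induct)
  case (4 w)
  then show ?case by (auto intro: atom_tok.intros)
next
  case 6
  then show ?case by (auto intro: atom_tok.intros)
qed simp

lemma lookup_actual:
  "atom_tok True AtN s \<Longrightarrow> lookup \<alpha> s = {if \<alpha> (index s) then Zer else One}"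
  by (induction True "AtN" s arbitrary: \<alpha> rule: atom_tok.induct) auto

lemma ex_numeral: "\<exists>s. atom_tok True AtN s \<and> index s = m"
proof (induction m)
  case 0
  show ?case by (intro exI[of _ Zer]) (auto intro: atom_tok.intros)
next
  case (Suc m)
  then obtain s where "atom_tok True AtN s" "index s = m" by blast
  then show ?case by (intro exI[of _ "Su s"]) (auto intro: atom_tok.intros)
qed

text \<open>\<open>Fn xs b\<close> belongs to the graph as soon as one token \<open>s\<close> of
  \<open>xs\<close> yields \<open>b\<close>, and this reads the sequence only at
  \<open>index s\<close>.\<close>

lemma bits_local: "t \<in> bits \<alpha> \<Longrightarrow> \<exists>k. \<forall>\<beta>. \<beta> k = \<alpha> k \<longrightarrow> t \<in> bits \<beta>"
proof -
  assume "t \<in> bits \<alpha>"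
  then obtain xs b s where t: "t = Fn xs b" "s \<in> set xs" "b \<in> lookup \<alpha> s"
    by (auto simp: bits_def lam_def)
  have "t \<in> bits \<beta>" if "\<beta> (index s) = \<alpha> (index s)" for \<beta>
    using t lookup_local[of \<beta> s \<alpha>, OF that] by (auto simp: bits_def lam_def)
  then show ?thesis by blast
qed

lemma app_lam_const [simp]: "app (lam (\<lambda>x. c)) y = c"
  using app_lam_cont[OF cont_const, where y = y] by simp

section \<open>The types occurring in Markov's principle\<close>

definition is_zero_fam :: "(nat \<Rightarrow> bool) \<Rightarrow> dom" where
  "is_zero_fam \<alpha> = lam (\<lambda>x. elim {Atm AtN1} {Atm AtN0} {} (app (bits \<alpha>) x))"

definition some_zero :: "(nat \<Rightarrow> bool) \<Rightarrow> dom" where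
  "some_zero \<alpha> = sig_code {Atm AtN} (is_zero_fam \<alpha>)"

lemma app_is_zero_fam [simp]:
  "app (is_zero_fam \<alpha>) {s} = elim {Atm AtN1} {Atm AtN0} {} (lookup \<alpha> s)"
  unfolding is_zero_fam_def
  using app_lam_cont[OF cont_elim[OF cont_const cont_const cont_const cont_app[OF cont_const cont_var[of 0]]],
      where y = "{s}"] by simp

lemma den_SomeZero [simp]: "den (SomeZero (Var 0)) (case_nat (bits \<alpha>) \<rho>) = some_zero \<alpha>"
  by (simp add: some_zero_def is_zero_fam_def SomeZero_def IsZero_def)

abbreviation arrow :: "dom \<Rightarrow> dom \<Rightarrow> dom" where
  "arrow A B \<equiv> pi_code A (lam (\<lambda>_. B))"

lemma eeq_arrowD:
  assumes "eeq w (arrow A B) f g" "eeq w A x y"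
  shows "eeq w B (app f x) (app g y)"
  using assms large.eeq_pi_iff[OF large.eeq_type[OF assms(1)]] by simp

lemma teq_arrowD:
  assumes "teq w (arrow A B) (arrow A B)"
  shows "teq w A A" and "eeq w A x y \<Longrightarrow> teq w B B"
  using assms by (auto simp: large.teq_pi_iff)

lemma eeq_bits: "eeq w (den (Arr NN N2) \<rho>) (bits \<alpha>) (bits \<alpha>)"
proof -
  have "teq w (den (Arr NN N2) \<rho>) (den (Arr NN N2) \<rho>)"
    by (simp add: Arr_def large.teq_pi_iff)
  then show ?thesis
    by (simp add: Arr_def large.eeq_pi_iff)
      (use lookup_bool in \<open>force simp: large.eeq_atom_iff\<close>)
qed

lemma eeq_some_zeroD:
  assumes "eeq w (some_zero \<alpha>) p q"
  shows "\<exists>s. atom_tok w AtN s \<and> proj1 p = {s} \<and>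
    eeq w (elim {Atm AtN1} {Atm AtN0} {} (lookup \<alpha> s)) (proj2 p) (proj2 q)"
proof -
  have "eeq w {Atm AtN} (proj1 p) (proj1 q)"
    and 2: "eeq w (app (is_zero_fam \<alpha>) (proj1 p)) (proj2 p) (proj2 q)"
    using assms large.eeq_sig_iff[OF large.eeq_type[OF assms, unfolded some_zero_def]]
    by (simp_all add: some_zero_def)
  then obtain s where "atom_tok w AtN s" "proj1 p = {s}" by (auto simp: large.eeq_atom_iff)
  then show ?thesis using 2 by auto
qed

lemma eeq_some_zeroI:
  assumes ty: "teq True (some_zero \<alpha>) (some_zero \<alpha>)" and "\<alpha> m"
  shows "\<exists>p. eeq True (some_zero \<alpha>) p p"
proof -
  obtain s where s: "atom_tok True AtN s" "index s = m" using ex_numeral by blast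
  \<comment> \<open>\<open>Zer\<close> is here the element of \<open>N1\<close>, which is the fibre
    over a zero of the sequence.\<close>
  have "eeq True (some_zero \<alpha>) (pair {s} {Zer}) (pair {s} {Zer})"
    using large.eeq_sig_iff[OF ty[unfolded some_zero_def]] s \<open>\<alpha> m\<close> lookup_actual[OF s(1), of \<alpha>]
    by (simp add: some_zero_def large.eeq_atom_iff atom_tok.intros)
  then show ?thesis by blast
qed

lemma no_atom_N0: "\<not> eeq True {Atm AtN0} x y"
  by (auto simp: large.eeq_atom_iff elim: atom_tok.cases)

text \<open>In the potential world the exception returned lies in \<open>N0\<close>. In the actual
  world there is nothing to check: an element of \<open>\<not>A\<close> applied to \<open>p\<close>
  would give an element of the empty type.\<close>

lemma eeq_raise_neg_neg:
  assumes ty: "teq w (arrow (arrow A {Atm AtN0}) {Atm AtN0}) (arrow (arrow A {Atm AtN0}) {Atm AtN0})"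
    and A: "w \<Longrightarrow> eeq True A p p"
  shows "eeq w (arrow (arrow A {Atm AtN0}) {Atm AtN0}) {Err} {Err}"
  unfolding large.eeq_pi_iff[OF ty]
proof (intro allI impI)
  fix v a b assume v: "v \<le> w" and ab: "eeq v (arrow A {Atm AtN0}) a b"
  show "eeq v (app (lam (\<lambda>_. {Atm AtN0})) a) (app {Err} a) (app {Err} b)"
  proof (cases v)
    case True
    then show ?thesis using eeq_arrowD[OF ab] A no_atom_N0 v by auto
  next
    case False
    then show ?thesis by (auto simp: large.eeq_atom_iff intro: atom_tok.intros)
  qed
qed

theorem theorem1p1:
  shows "\<not> (\<exists>t. [] \<turnstile> t \<Ztypecolon> MP)"
proof
  assume "\<exists>t. [] \<turnstile> t \<Ztypecolon> MP"
  then obtain t where t: "[] \<turnstile> t \<Ztypecolon> MP" by blast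
  define T where "T = den t (\<lambda>_. {})"
  \<comment> \<open>The exception stands in for the proof of the double negation.\<close>
  define R where "R \<alpha> = app (app T (bits \<alpha>)) {Err}" for \<alpha>
  let ?NN = "\<lambda>A. arrow (arrow A {Atm AtN0}) {Atm AtN0}"
  have T: "eeq w (arrow (?NN (some_zero \<alpha>)) (some_zero \<alpha>)) (app T (bits \<alpha>)) (app T (bits \<alpha>))" for w \<alpha>
    using sem_term_piD[OF soundness(4)[OF t, unfolded MP_def], of w "\<lambda>_. {}" "\<lambda>_. {}" "bits \<alpha>" "bits \<alpha>"]
      eeq_bits by (simp add: T_def Arr_def Neg_def)
  \<comment> \<open>These typings are inherited from \<open>T\<close>, as domains of arrow codes
    already known to be types.\<close>
  have tyNN: "teq w (?NN (some_zero \<alpha>)) (?NN (some_zero \<alpha>))" for w \<alpha>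
    using teq_arrowD(1)[OF large.eeq_type[OF T]] .
  have ty: "teq w (some_zero \<alpha>) (some_zero \<alpha>)" for w \<alpha>
    using teq_arrowD(1)[OF teq_arrowD(1)[OF tyNN]] .
  \<comment> \<open>At world \<open>False\<close> this holds for every sequence; at world
    \<open>True\<close> a zero supplies the inhabitant that makes the negation empty.\<close>
  have R: "eeq w (some_zero \<alpha>) (R \<alpha>) (R \<alpha>)" if ex: "w \<Longrightarrow> \<exists>m. \<alpha> m" for w \<alpha>
  proof -
    have "\<exists>p. w \<longrightarrow> eeq True (some_zero \<alpha>) p p"
    proof (cases w)
      case True
      then obtain m where "\<alpha> m" using ex by blast
      then show ?thesis using eeq_some_zeroI[OF ty] by blast
    qed simp
    then obtain p where p: "w \<longrightarrow> eeq True (some_zero \<alpha>) p p" by blast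
    have "eeq w (?NN (some_zero \<alpha>)) {Err} {Err}"
      by (rule eeq_raise_neg_neg[OF tyNN]) (use p in simp)
    from eeq_arrowD[OF T this] show ?thesis unfolding R_def .
  qed
  \<comment> \<open>The constant sequence one is handled at the potential world, where the first
    component is already a single token.\<close>
  obtain s where s: "s \<in> proj1 (R (\<lambda>_. False))"
    using eeq_some_zeroD[OF R[of False]] by blast
  have cont: "cont (\<lambda>\<rho>. proj1 (app (app T (\<rho> 0)) {Err}))"
    by (intro cont_proj1 cont_app cont_const cont_var)
  \<comment> \<open>\<open>\<rho> 0\<close> is a finite part of the graph of that sequence that
    suffices to produce \<open>s\<close>.\<close>
  obtain \<rho> where \<rho>: "fin_below \<rho> (\<lambda>_. bits (\<lambda>_. False))" "s \<in> proj1 (app (app T (\<rho> 0)) {Err})"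
    using cont_finD[OF cont, of s "\<lambda>_. bits (\<lambda>_. False)"] s unfolding R_def by blast
  have "\<forall>u\<in>\<rho> 0. \<exists>k. \<forall>\<beta>. \<not> \<beta> k \<longrightarrow> u \<in> bits \<beta>"
  proof
    fix u assume "u \<in> \<rho> 0"
    moreover have "\<rho> 0 \<subseteq> bits (\<lambda>_. False)" using \<rho>(1) by (simp add: fin_below_def le_fun_def)
    ultimately have "u \<in> bits (\<lambda>_. False)" by blast
    from bits_local[OF this] show "\<exists>k. \<forall>\<beta>. \<not> \<beta> k \<longrightarrow> u \<in> bits \<beta>" by simp
  qed
  from bchoice[OF this] obtain k where k: "\<forall>u\<in>\<rho> 0. \<forall>\<beta>. \<not> \<beta> (k u) \<longrightarrow> u \<in> bits \<beta>" ..
  have "finite (insert (index s) (k ` \<rho> 0))" using \<rho>(1) by (simp add: fin_below_def)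
  \<comment> \<open>The zero goes to a place that no token of \<open>\<rho> 0\<close> inspects, away
    from the number \<open>s\<close> itself.\<close>
  then obtain m where m: "m \<notin> insert (index s) (k ` \<rho> 0)"
    using ex_new_if_finite infinite_UNIV_nat by blast
  define \<beta> where "\<beta> n \<longleftrightarrow> n = m" for n
  have "\<rho> 0 \<subseteq> bits \<beta>"
  proof
    fix u assume u: "u \<in> \<rho> 0"
    then have "\<not> \<beta> (k u)" using m by (auto simp: \<beta>_def)
    with u k show "u \<in> bits \<beta>" by blast
  qed
  then have s\<beta>: "s \<in> proj1 (R \<beta>)"
    unfolding R_def
    using cont_monoD[OF cont, of "\<lambda>_. \<rho> 0" "\<lambda>_. bits \<beta>"] \<rho>(2) by (auto simp: le_fun_def)
  \<comment> \<open>Since \<open>\<beta>\<close> has a zero, its result also belongs to the type in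
    the actual world.\<close>
  have "eeq True (some_zero \<beta>) (R \<beta>) (R \<beta>)" by (rule R) (simp add: \<beta>_def)
  from eeq_some_zeroD[OF this] obtain s' where s': "atom_tok True AtN s'" "proj1 (R \<beta>) = {s'}"
    "eeq True (elim {Atm AtN1} {Atm AtN0} {} (lookup \<beta> s')) (proj2 (R \<beta>)) (proj2 (R \<beta>))" by blast
  \<comment> \<open>Otherwise the fibre over \<open>s'\<close> would be \<open>N0\<close>, which is
    empty in the actual world.\<close>
  then have "\<beta> (index s')" using no_atom_N0 lookup_actual[of s' \<beta>] by (cases "\<beta> (index s')") auto
  \<comment> \<open>Both \<open>s\<close> and \<open>s'\<close> lie in the singleton
    \<open>proj1 (R \<beta>)\<close>, so \<open>index s = m\<close>, against the choice of
    \<open>m\<close>.\<close>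
  then show False using s\<beta> s'(2) m by (simp add: \<beta>_def)
qed

end
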